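(* The tensor product $\mathfrak{L}$-module $\bm{T}=\big(\bigotimes_{i=1}^m\Phi(\lambda_i,\alpha_i,\beta_i,\gamma_i,h_i(t_i))\big)\otimes V$ described in the context is irreducible if and only if $\lambda_1,\ldots,\lambda_m$ are pairwise distinct.
   Context: All vector spaces are over $\mathbb{C}$; $\mathbb{C}^*$ denotes the nonzero complex numbers, $\mathbb{Z}_+$ the nonnegative integers, $\mathbb{N}$ the positive integers. The BMS-Kac-Moody algebra $\mathfrak{L}$ is the Lie algebra with basis $\{L_m,W_m,I_m,J_m\mid m\in\mathbb{Z}\}$ and nontrivial brackets $[L_m,L_n]=(n-m)L_{m+n}$, $[L_m,W_n]=(n-m)W_{m+n}$, $[L_m,I_n]=nI_{m+n}$, $[L_m,J_n]=nJ_{m+n}$, $[W_m,I_n]=-nJ_{m+n}$ for $m,n\in\mathbb{Z}$ (all other brackets of basis elements, up to skew-symmetry, are zero). It is $\mathbb{Z}$-graded with $\mathfrak{L}_n=\mathbb{C}L_n\oplus\mathbb{C}W_n\oplus\mathbb{C}I_n\oplus\mathbb{C}J_n$. For $\lambda\in\mathbb{C}^*$, $\alpha,\beta,\gamma\in\mathbb{C}$, $h(t)\in\mathbb{C}[t]$, the $\mathfrak{L}$-module $\Phi(\lambda,\alpha,\beta,\gamma,h(t))$ is the vector space $\mathbb{C}[s,t]$ with, for $f(s,t)\in\mathbb{C}[s,t]$ and $n\in\mathbb{Z}$, $L_n(f(s,t))=\lambda^n(s+h_{(n)}(t))f(s-n,t)-n\lambda^n(t-n\alpha)\frac{\partial}{\partial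 t}(f(s-n,t))$, $W_n(f(s,t))=\lambda^n(t-n\alpha)f(s-n,t)$, $I_n(f(s,t))=\lambda^n\big(\gamma-n\beta H(t)\big)f(s-n,t)+n\lambda^n\beta\frac{\partial}{\partial t}(f(s-n,t))$, $J_n(f(s,t))=\lambda^n\beta f(s-n,t)$, where $H(t)=\frac{h(t)-h(\alpha)}{t-\alpha}$ and $h_{(n)}(t)=nh(t)-n(n-1)\alpha H(t)$. An $\mathfrak{L}$-module $V$ is restricted if for every $v\in V$ there is $k\in\mathbb{Z}_+$ with $\mathfrak{L}_n\cdot v=0$ for all $n\geq k$. Tensor product module: let $m\in\mathbb{N}$. For $1\leq i\leq m$ let $\gamma_i\in\mathbb{C}$, let $\lambda_i\in\mathbb{C}^*$, $\alpha_i,\beta_i\in\mathbb{C}$ with $\alpha_i\neq0$ or $\beta_i\neq0$, and $h_i(t_i)\in\mathbb{C}[t_i]$; regard $\Phi(\lambda_i,\alpha_i,\beta_i,\gamma_i,h_i(t_i))$ as $\mathbb{C}[s_i,t_i]$. Let $V$ be an irreducible restricted $\mathfrak{L}$-module. Then $\bm{T}=\big(\bigotimes_{i=1}^m\Phi(\lambda_i,\alpha_i,\beta_i,\gamma_i,h_i(t_i))\big)\otimes V$ with the usual tensor product action. *)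

theory Defs
  imports Complex_Main "HOL-Computational_Algebra.Polynomial" "HOL-Library.Poly_Mapping"
begin

section \<open>Complex vector spaces\<close>

class scaleC =
  fixes scaleC :: "complex \<Rightarrow> 'a \<Rightarrow> 'a"  (infixr "*\<^sub>C" 75)

class complex_vector = scaleC + ab_group_add +
  assumes scaleC_add_right: "a *\<^sub>C (x + y) = a *\<^sub>C x + a *\<^sub>C y"
    and scaleC_add_left: "(a + b) *\<^sub>C x = a *\<^sub>C x + b *\<^sub>C x"
    and scaleC_scaleC: "a *\<^sub>C b *\<^sub>C x = (a * b) *\<^sub>C x"
    and scaleC_one: "1 *\<^sub>C x = x"

global_interpretation complex_vector: vector_space "scaleC :: complex \<Rightarrow> 'a \<Rightarrow> 'a::complex_vector"
  by unfold_locales (simp_all add: scaleC_add_right scaleC_add_left scaleC_scaleC scaleC_one)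

abbreviation clinear :: "('a::complex_vector \<Rightarrow> 'b::complex_vector) \<Rightarrow> bool"
  where "clinear \<equiv> Vector_Spaces.linear scaleC scaleC"

lemma clinearI:
  assumes "\<And>x y. f (x + y) = f x + f y" and "\<And>c x. f (c *\<^sub>C x) = c *\<^sub>C f x"
  shows "clinear f"
  unfolding Vector_Spaces.linear_iff by (auto intro: complex_vector.vector_space_axioms simp: assms)

lemma clinear_add: "clinear f \<Longrightarrow> f (x + y) = f x + f y"
  and clinear_scale: "clinear f \<Longrightarrow> f (c *\<^sub>C x) = c *\<^sub>C f x"
  by (simp_all add: Vector_Spaces.linear_iff)

lemma clinear_module_hom: "clinear f \<Longrightarrow> module_hom scaleC scaleC f"
  by (simp add: module_hom_iff_linear)

lemmas clinear_0 = module_hom.zero[OF clinear_module_hom]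
  and clinear_diff = module_hom.diff[OF clinear_module_hom]
  and clinear_neg = module_hom.neg[OF clinear_module_hom]
  and clinear_sum = module_hom.sum[OF clinear_module_hom]

instantiation complex :: complex_vector
begin
definition "(c::complex) *\<^sub>C z = c * z"
instance by standard (simp_all add: scaleC_complex_def algebra_simps)
end

instantiation poly :: (complex_vector) complex_vector
begin
definition "(c::complex) *\<^sub>C p = map_poly (scaleC c) p"
instance
proof
  have [simp]: "coeff (c *\<^sub>C p) n = c *\<^sub>C coeff p n" for c n and p :: "'a poly"
    by (simp add: scaleC_poly_def coeff_map_poly)
  fix a b :: complex and x y :: "'a poly"
  show "a *\<^sub>C (x + y) = a *\<^sub>C x + a *\<^sub>C y"
    by (simp add: poly_eq_iff scaleC_add_right)
  show "(a + b) *\<^sub>C x = a *\<^sub>C x + b *\<^sub>C x"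
    by (simp add: poly_eq_iff scaleC_add_left)
  show "a *\<^sub>C b *\<^sub>C x = (a * b) *\<^sub>C x"
    by (simp add: poly_eq_iff scaleC_scaleC)
  show "1 *\<^sub>C x = x"
    by (simp add: poly_eq_iff scaleC_one)
qed
end

lemma coeff_scaleC [simp]: "coeff (c *\<^sub>C p) n = c *\<^sub>C coeff p n"
  by (simp add: scaleC_poly_def coeff_map_poly)

lemma scaleC_poly_eq_smult: "c *\<^sub>C (p :: complex poly) = smult c p"
  by (simp add: poly_eq_iff scaleC_complex_def)

lemma scaleC_poly_poly_eq_smult: "c *\<^sub>C (p :: complex poly poly) = smult [:c:] p"
  by (simp add: poly_eq_iff scaleC_complex_def)

text \<open>The vector space with basis \<^typ>\<open>'b\<close> is \<^typ>\<open>'b \<Rightarrow>\<^sub>0 complex\<close>; a basis vector is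
  \<open>Poly_Mapping.single b 1\<close>.\<close>

instantiation poly_mapping :: (type, complex_vector) complex_vector
begin
lift_definition scaleC_poly_mapping :: "complex \<Rightarrow> ('a \<Rightarrow>\<^sub>0 'b) \<Rightarrow> 'a \<Rightarrow>\<^sub>0 'b"
  is "\<lambda>c f k. c *\<^sub>C f k"
  by (erule finite_subset[rotated]) auto
instance
  by standard (transfer; simp add: fun_eq_iff scaleC_add_right scaleC_add_left scaleC_scaleC scaleC_one)+
end

lemma lookup_scaleC [simp]: "Poly_Mapping.lookup (c *\<^sub>C x) k = c *\<^sub>C Poly_Mapping.lookup x k"
  by transfer simp

definition lin_ext :: "('b \<Rightarrow> 'v) \<Rightarrow> ('b \<Rightarrow>\<^sub>0 complex) \<Rightarrow> 'v::complex_vector"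
  where "lin_ext \<phi> x = (\<Sum>b\<in>Poly_Mapping.keys x. Poly_Mapping.lookup x b *\<^sub>C \<phi> b)"

lemma lin_ext_superset:
  assumes "finite A" "Poly_Mapping.keys x \<subseteq> A"
  shows "lin_ext \<phi> x = (\<Sum>b\<in>A. Poly_Mapping.lookup x b *\<^sub>C \<phi> b)"
  unfolding lin_ext_def using assms
  by (intro sum.mono_neutral_left) (auto simp: in_keys_iff)

lemma lin_ext_single [simp]: "lin_ext \<phi> (Poly_Mapping.single b c) = c *\<^sub>C \<phi> b"
  by (subst lin_ext_superset[of "{b}"]) auto

lemma clinear_lin_ext: "clinear (lin_ext \<phi>)"
proof (rule clinearI)
  fix x y :: "'a \<Rightarrow>\<^sub>0 complex"
  have "Poly_Mapping.keys (x + y) \<subseteq> Poly_Mapping.keys x \<union> Poly_Mapping.keys y" by (rule keys_add)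
  then show "lin_ext \<phi> (x + y) = lin_ext \<phi> x + lin_ext \<phi> y"
    by (simp add: lin_ext_superset[of "Poly_Mapping.keys x \<union> Poly_Mapping.keys y"] lookup_add scaleC_add_left sum.distrib)
next
  fix c and x :: "'a \<Rightarrow>\<^sub>0 complex"
  have "Poly_Mapping.keys (c *\<^sub>C x) \<subseteq> Poly_Mapping.keys x"
    by (auto simp: in_keys_iff scaleC_complex_def)
  then show "lin_ext \<phi> (c *\<^sub>C x) = c *\<^sub>C lin_ext \<phi> x"
    by (simp add: lin_ext_superset[of "Poly_Mapping.keys x"] complex_vector.scale_sum_right scaleC_complex_def)
qed

lemma free_eq_sum: "x = (\<Sum>b\<in>Poly_Mapping.keys x. Poly_Mapping.lookup x b *\<^sub>C Poly_Mapping.single b (1::complex))"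
proof (rule poly_mapping_eqI)
  fix k
  have "Poly_Mapping.lookup (\<Sum>b\<in>Poly_Mapping.keys x.
      Poly_Mapping.lookup x b *\<^sub>C Poly_Mapping.single b (1::complex)) k
    = (\<Sum>b\<in>Poly_Mapping.keys x. if b = k then Poly_Mapping.lookup x b else 0)"
    unfolding lookup_sum by (intro sum.cong) (auto simp: lookup_single scaleC_complex_def)
  also have "\<dots> = Poly_Mapping.lookup x k"
    by (simp add: in_keys_iff)
  finally show "Poly_Mapping.lookup x k = Poly_Mapping.lookup (\<Sum>b\<in>Poly_Mapping.keys x.
      Poly_Mapping.lookup x b *\<^sub>C Poly_Mapping.single b (1::complex)) k" ..
qed

lemma clinear_free_eqI:
  assumes "clinear F" "clinear G"
    and "\<And>b. F (Poly_Mapping.single b 1) = G (Poly_Mapping.single b (1::complex))"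
  shows "F x = G x"
proof -
  let ?x = "\<Sum>b\<in>Poly_Mapping.keys x. Poly_Mapping.lookup x b *\<^sub>C Poly_Mapping.single b (1::complex)"
  have "F ?x = G ?x"
    by (simp only: clinear_sum[OF assms(1)] clinear_sum[OF assms(2)] clinear_scale[OF assms(1)]
        clinear_scale[OF assms(2)] assms(3))
  then show ?thesis by (simp only: free_eq_sum[symmetric])
qed


section \<open>Lie modules\<close>

definition lie_algebra :: "('g::complex_vector \<Rightarrow> 'g \<Rightarrow> 'g) \<Rightarrow> bool"
  where "lie_algebra br \<longleftrightarrow>
    (\<forall>x. clinear (br x)) \<and> (\<forall>y. clinear (\<lambda>x. br x y)) \<and>
    (\<forall>x. br x x = 0) \<and>
    (\<forall>x y z. br x (br y z) + br y (br z x) + br z (br x y) = 0)"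

definition lie_module :: "('g::complex_vector \<Rightarrow> 'g \<Rightarrow> 'g) \<Rightarrow> ('g \<Rightarrow> 'v::complex_vector \<Rightarrow> 'v) \<Rightarrow> bool"
  where "lie_module br act \<longleftrightarrow>
    (\<forall>x. clinear (act x)) \<and> (\<forall>v. clinear (\<lambda>x. act x v)) \<and>
    (\<forall>x y v. act (br x y) v = act x (act y v) - act y (act x v))"

definition submodule :: "('g \<Rightarrow> 'v::complex_vector \<Rightarrow> 'v) \<Rightarrow> 'v set \<Rightarrow> bool"
  where "submodule act U \<longleftrightarrow> complex_vector.subspace U \<and> (\<forall>x. \<forall>u\<in>U. act x u \<in> U)"

definition irreducible_module :: "('g \<Rightarrow> 'v::complex_vector \<Rightarrow> 'v) \<Rightarrow> bool"
  where "irreducible_module act \<longleftrightarrow>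
    (\<exists>v::'v. v \<noteq> 0) \<and> (\<forall>U. submodule act U \<longrightarrow> U = {0} \<or> U = UNIV)"


section \<open>The BMS-Kac-Moody algebra\<close>

datatype bms_basis = Lb int | Wb int | Ib int | Jb int

type_synonym bms = "bms_basis \<Rightarrow>\<^sub>0 complex"

abbreviation bms_L :: "int \<Rightarrow> bms" where "bms_L n \<equiv> Poly_Mapping.single (Lb n) 1"
abbreviation bms_W :: "int \<Rightarrow> bms" where "bms_W n \<equiv> Poly_Mapping.single (Wb n) 1"
abbreviation bms_I :: "int \<Rightarrow> bms" where "bms_I n \<equiv> Poly_Mapping.single (Ib n) 1"
abbreviation bms_J :: "int \<Rightarrow> bms" where "bms_J n \<equiv> Poly_Mapping.single (Jb n) 1"

fun bms_basis_bracket :: "bms_basis \<Rightarrow> bms_basis \<Rightarrow> bms" where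
  "bms_basis_bracket (Lb m) (Lb n) = of_int (n - m) *\<^sub>C bms_L (m + n)"
| "bms_basis_bracket (Lb m) (Wb n) = of_int (n - m) *\<^sub>C bms_W (m + n)"
| "bms_basis_bracket (Lb m) (Ib n) = of_int n *\<^sub>C bms_I (m + n)"
| "bms_basis_bracket (Lb m) (Jb n) = of_int n *\<^sub>C bms_J (m + n)"
| "bms_basis_bracket (Wb m) (Ib n) = - of_int n *\<^sub>C bms_J (m + n)"
| "bms_basis_bracket (Wb n) (Lb m) = - (of_int (n - m) *\<^sub>C bms_W (m + n))"
| "bms_basis_bracket (Ib n) (Lb m) = - (of_int n *\<^sub>C bms_I (m + n))"
| "bms_basis_bracket (Jb n) (Lb m) = - (of_int n *\<^sub>C bms_J (m + n))"
| "bms_basis_bracket (Ib n) (Wb m) = - (- of_int n *\<^sub>C bms_J (m + n))"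
| "bms_basis_bracket _ _ = 0"

definition bms_bracket :: "bms \<Rightarrow> bms \<Rightarrow> bms"
  where "bms_bracket x y = lin_ext (\<lambda>a. lin_ext (bms_basis_bracket a) y) x"

definition bms_homogeneous :: "int \<Rightarrow> bms set"
  where "bms_homogeneous n = complex_vector.span {bms_L n, bms_W n, bms_I n, bms_J n}"

definition restricted_module :: "(bms \<Rightarrow> 'v::complex_vector \<Rightarrow> 'v) \<Rightarrow> bool"
  where "restricted_module act \<longleftrightarrow>
    (\<forall>v. \<exists>k::nat. \<forall>n::int. n \<ge> int k \<longrightarrow> (\<forall>x\<in>bms_homogeneous n. act x v = 0))"


section \<open>The modules \<open>\<Phi>(\<lambda>, \<alpha>, \<beta>, \<gamma>, h(t))\<close>\<close>

text \<open>An element of \<open>\<complex>[s,t]\<close> is a \<^typ>\<open>complex poly poly\<close>: a polynomial in \<open>s\<close> whose coefficients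
  are polynomials in \<open>t\<close>. Thus a polynomial \<open>p(t)\<close> is embedded as \<open>[:p:]\<close> and the variable \<open>s\<close>
  is \<open>[:0, 1:]\<close>.\<close>

definition shift_s :: "int \<Rightarrow> complex poly poly \<Rightarrow> complex poly poly"
  where "shift_s n f = pcompose f [:- of_int n, 1:]"

definition deriv_t :: "complex poly poly \<Rightarrow> complex poly poly"
  where "deriv_t f = map_poly pderiv f"

text \<open>The division below is exact, since \<open>\<alpha>\<close> is a root of \<open>h(t) - h(\<alpha>)\<close>.\<close>

definition phi_H :: "complex \<Rightarrow> complex poly \<Rightarrow> complex poly"
  where "phi_H \<alpha> h = (h - [:poly h \<alpha>:]) div [:- \<alpha>, 1:]"

definition phi_h :: "complex \<Rightarrow> complex poly \<Rightarrow> int \<Rightarrow> complex poly"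
  where "phi_h \<alpha> h n = smult (of_int n) h - smult (of_int (n * (n - 1)) * \<alpha>) (phi_H \<alpha> h)"

fun phi_basis ::
  "complex \<Rightarrow> complex \<Rightarrow> complex \<Rightarrow> complex \<Rightarrow> complex poly \<Rightarrow> bms_basis \<Rightarrow>
    complex poly poly \<Rightarrow> complex poly poly" where
  "phi_basis lam \<alpha> \<beta> \<gamma> h (Lb n) f =
     (lam powi n) *\<^sub>C (([:0, 1:] + [:phi_h \<alpha> h n:]) * shift_s n f)
     - (of_int n * lam powi n) *\<^sub>C ([:[:- of_int n * \<alpha>, 1:]:] * deriv_t (shift_s n f))"
| "phi_basis lam \<alpha> \<beta> \<gamma> h (Wb n) f =
     (lam powi n) *\<^sub>C ([:[:- of_int n * \<alpha>, 1:]:] * shift_s n f)"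
| "phi_basis lam \<alpha> \<beta> \<gamma> h (Ib n) f =
     (lam powi n) *\<^sub>C ([:[:\<gamma>:] - smult (of_int n * \<beta>) (phi_H \<alpha> h):] * shift_s n f)
     + (of_int n * lam powi n * \<beta>) *\<^sub>C deriv_t (shift_s n f)"
| "phi_basis lam \<alpha> \<beta> \<gamma> h (Jb n) f = (lam powi n * \<beta>) *\<^sub>C shift_s n f"

definition phi_act ::
  "complex \<Rightarrow> complex \<Rightarrow> complex \<Rightarrow> complex \<Rightarrow> complex poly \<Rightarrow> bms \<Rightarrow>
    complex poly poly \<Rightarrow> complex poly poly"
  where "phi_act lam \<alpha> \<beta> \<gamma> h x f = lin_ext (\<lambda>b. phi_basis lam \<alpha> \<beta> \<gamma> h b f) x"


section \<open>Tensor products\<close>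

text \<open>\<open>('i, 'a, 'v) tensor\<close> is the tensor product of a family of copies of \<^typ>\<open>'a\<close>, indexed by
  the finite type \<^typ>\<open>'i\<close>, and one copy of \<^typ>\<open>'v\<close>: the vector space with basis
  \<open>('i \<Rightarrow> 'a) \<times> 'v\<close> modulo the multilinearity relations.\<close>

definition free_pure :: "('i \<Rightarrow> 'a) \<Rightarrow> 'v \<Rightarrow> ('i \<Rightarrow> 'a) \<times> 'v \<Rightarrow>\<^sub>0 complex"
  where "free_pure f v = Poly_Mapping.single (f, v) 1"

definition tensor_relations ::
  "(('i \<Rightarrow> 'a::complex_vector) \<times> 'v::complex_vector \<Rightarrow>\<^sub>0 complex) set"
  where "tensor_relations =
    {free_pure (f(i := a + b)) v - free_pure (f(i := a)) v - free_pure (f(i := b)) v | f i a b v. True}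
    \<union> {free_pure (f(i := c *\<^sub>C a)) v - c *\<^sub>C free_pure (f(i := a)) v | f i c a v. True}
    \<union> {free_pure f (v + w) - free_pure f v - free_pure f w | f v w. True}
    \<union> {free_pure f (c *\<^sub>C v) - c *\<^sub>C free_pure f v | f c v. True}"

definition tensor_rel ::
  "(('i \<Rightarrow> 'a::complex_vector) \<times> 'v::complex_vector \<Rightarrow>\<^sub>0 complex) \<Rightarrow>
   (('i \<Rightarrow> 'a) \<times> 'v \<Rightarrow>\<^sub>0 complex) \<Rightarrow> bool"
  where "tensor_rel x y \<longleftrightarrow> x - y \<in> complex_vector.span tensor_relations"

quotient_type (overloaded) ('i, 'a, 'v) tensor =
  "(('i::finite) \<Rightarrow> ('a::complex_vector)) \<times> ('v::complex_vector) \<Rightarrow>\<^sub>0 complex" / tensor_rel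
proof (rule equivpI)
  show "reflp (tensor_rel :: (('i \<Rightarrow> 'a) \<times> 'v \<Rightarrow>\<^sub>0 complex) \<Rightarrow> _)"
    by (simp add: reflp_def tensor_rel_def complex_vector.span_zero)
  show "symp (tensor_rel :: (('i \<Rightarrow> 'a) \<times> 'v \<Rightarrow>\<^sub>0 complex) \<Rightarrow> _)"
    unfolding symp_def tensor_rel_def by (metis complex_vector.span_neg minus_diff_eq)
  show "transp (tensor_rel :: (('i \<Rightarrow> 'a) \<times> 'v \<Rightarrow>\<^sub>0 complex) \<Rightarrow> _)"
  proof (rule transpI)
    fix x y z :: "('i \<Rightarrow> 'a) \<times> 'v \<Rightarrow>\<^sub>0 complex"
    assume "tensor_rel x y" "tensor_rel y z"
    then have "(x - y) + (y - z) \<in> complex_vector.span tensor_relations"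
      unfolding tensor_rel_def by (rule complex_vector.span_add)
    then show "tensor_rel x z" by (simp add: tensor_rel_def)
  qed
qed

instantiation tensor :: (finite, complex_vector, complex_vector) complex_vector
begin
lift_definition zero_tensor :: "('a, 'b, 'c) tensor" is 0 .
lift_definition plus_tensor :: "('a, 'b, 'c) tensor \<Rightarrow> ('a, 'b, 'c) tensor \<Rightarrow> ('a, 'b, 'c) tensor"
  is "(+)"
  unfolding tensor_rel_def by (metis add_diff_add complex_vector.span_add)
lift_definition uminus_tensor :: "('a, 'b, 'c) tensor \<Rightarrow> ('a, 'b, 'c) tensor" is uminus
  unfolding tensor_rel_def by (metis complex_vector.span_neg minus_diff_minus)
lift_definition minus_tensor :: "('a, 'b, 'c) tensor \<Rightarrow> ('a, 'b, 'c) tensor \<Rightarrow> ('a, 'b, 'c) tensor"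
  is "(-)"
proof -
  fix x y z w :: "('a \<Rightarrow> 'b) \<times> 'c \<Rightarrow>\<^sub>0 complex"
  assume "tensor_rel x y" "tensor_rel z w"
  then have "(x - y) - (z - w) \<in> complex_vector.span tensor_relations"
    unfolding tensor_rel_def by (rule complex_vector.span_diff)
  moreover have "(x - y) - (z - w) = (x - z) - (y - w)" by (simp add: algebra_simps)
  ultimately show "tensor_rel (x - z) (y - w)" by (simp add: tensor_rel_def)
qed
lift_definition scaleC_tensor :: "complex \<Rightarrow> ('a, 'b, 'c) tensor \<Rightarrow> ('a, 'b, 'c) tensor"
  is "scaleC"
  unfolding tensor_rel_def
  by (metis complex_vector.scale_right_diff_distrib complex_vector.span_scale)
instance
proof
  fix x y z :: "('a, 'b, 'c) tensor" and a b :: complex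
  have eq: "tensor_rel u u" for u :: "('a \<Rightarrow> 'b) \<times> 'c \<Rightarrow>\<^sub>0 complex"
    by (simp add: tensor_rel_def complex_vector.span_zero)
  show "x + y + z = x + (y + z)" by transfer (simp add: eq add.assoc)
  show "x + y = y + x" by transfer (simp add: eq add.commute)
  show "0 + x = x" by transfer (simp add: eq)
  show "- x + x = 0" by transfer (simp add: eq)
  show "x - y = x + - y" by transfer (simp add: eq)
  show "a *\<^sub>C (x + y) = a *\<^sub>C x + a *\<^sub>C y" by transfer (simp add: eq scaleC_add_right)
  show "(a + b) *\<^sub>C x = a *\<^sub>C x + b *\<^sub>C x" by transfer (simp add: eq scaleC_add_left)
  show "a *\<^sub>C b *\<^sub>C x = (a * b) *\<^sub>C x" by transfer (simp add: eq scaleC_scaleC)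
  show "1 *\<^sub>C x = x" by transfer (simp add: eq scaleC_one)
qed
end

lift_definition pure :: "('i::finite \<Rightarrow> 'a::complex_vector) \<Rightarrow> 'v::complex_vector \<Rightarrow> ('i, 'a, 'v) tensor"
  is free_pure .

definition multilinear ::
  "(('i \<Rightarrow> 'a::complex_vector) \<Rightarrow> 'v::complex_vector \<Rightarrow> 'w::complex_vector) \<Rightarrow> bool"
  where "multilinear \<phi> \<longleftrightarrow>
    (\<forall>f i v. clinear (\<lambda>a. \<phi> (f(i := a)) v)) \<and> (\<forall>f. clinear (\<phi> f))"

text \<open>The linear map induced by a multilinear map; see \<open>tensor_lift_unique_ex\<close>. Its value is
  arbitrary if \<open>\<phi>\<close> is not multilinear.\<close>

definition tensor_lift ::
  "(('i::finite \<Rightarrow> 'a::complex_vector) \<Rightarrow> 'v::complex_vector \<Rightarrow> 'w::complex_vector) \<Rightarrow>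
    ('i, 'a, 'v) tensor \<Rightarrow> 'w"
  where "tensor_lift \<phi> = (THE F. clinear F \<and> (\<forall>f v. F (pure f v) = \<phi> f v))"

definition tensor_act ::
  "('i::finite \<Rightarrow> 'g \<Rightarrow> 'a \<Rightarrow> 'a) \<Rightarrow> ('g \<Rightarrow> 'v \<Rightarrow> 'v) \<Rightarrow> 'g \<Rightarrow>
    ('i, 'a::complex_vector, 'v::complex_vector) tensor \<Rightarrow> ('i, 'a, 'v) tensor"
  where "tensor_act A B x =
    tensor_lift (\<lambda>f v. (\<Sum>i\<in>UNIV. pure (f(i := A i x (f i))) v) + pure f (B x v))"


section \<open>Well-definedness of the tensor product constructions\<close>

lemma abs_tensor_add: "abs_tensor (x + y) = abs_tensor x + abs_tensor y"
  and abs_tensor_scaleC: "abs_tensor (c *\<^sub>C x) = c *\<^sub>C abs_tensor x"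
  by (simp_all add: plus_tensor.abs_eq scaleC_tensor.abs_eq)

lemma clinear_abs_tensor: "clinear abs_tensor"
  by (rule clinearI) (simp_all add: abs_tensor_add abs_tensor_scaleC)

lemma abs_tensor_single: "abs_tensor (Poly_Mapping.single b 1) = pure (fst b) (snd b)"
  by (simp add: pure.abs_eq free_pure_def)

lemma abs_tensor_surj: obtains x where "T = abs_tensor x"
  using Quotient3_abs_rep[OF Quotient3_tensor] by metis

lemma tensor_linear_eqI:
  assumes "clinear F" "clinear G" and "\<And>f v. F (pure f v) = G (pure f v)"
  shows "F T = G T"
proof -
  obtain x where T: "T = abs_tensor x" by (rule abs_tensor_surj)
  have "clinear (\<lambda>x. F (abs_tensor x))" "clinear (\<lambda>x. G (abs_tensor x))"
    by (rule clinearI; simp add: abs_tensor_add abs_tensor_scaleC clinear_add[OF assms(1)]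
      clinear_add[OF assms(2)] clinear_scale[OF assms(1)] clinear_scale[OF assms(2)])+
  then show ?thesis
    unfolding T by (rule clinear_free_eqI) (simp add: abs_tensor_single assms(3))
qed

lemma multilinear_pure:
  "multilinear (pure :: ('i::finite \<Rightarrow> 'a::complex_vector) \<Rightarrow> 'v::complex_vector \<Rightarrow> _)"
proof -
  have base: "tensor_rel x y" if "x - y \<in> tensor_relations"
    for x y :: "('i \<Rightarrow> 'a) \<times> 'v \<Rightarrow>\<^sub>0 complex"
    unfolding tensor_rel_def using that by (rule complex_vector.span_base)
  show ?thesis
    unfolding multilinear_def
  proof (intro conjI allI clinearI)
    fix f :: "'i \<Rightarrow> 'a" and i v a b
    show "pure (f(i := a + b)) v = pure (f(i := a)) v + pure (f(i := b)) (v::'v)"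
      by transfer (rule base, unfold tensor_relations_def diff_diff_eq[symmetric], blast)
  next
    fix f :: "'i \<Rightarrow> 'a" and i v c a
    show "pure (f(i := c *\<^sub>C a)) v = c *\<^sub>C pure (f(i := a)) (v::'v)"
      by transfer (rule base, unfold tensor_relations_def, blast)
  next
    fix f :: "'i \<Rightarrow> 'a" and v w :: 'v
    show "pure f (v + w) = pure f v + pure f w"
      by transfer (rule base, unfold tensor_relations_def diff_diff_eq[symmetric], blast)
  next
    fix f :: "'i \<Rightarrow> 'a" and c and v :: 'v
    show "pure f (c *\<^sub>C v) = c *\<^sub>C pure f v"
      by transfer (rule base, unfold tensor_relations_def, blast)
  qed
qed

lemma tensor_lift_unique_ex:
  fixes \<phi> :: "('i::finite \<Rightarrow> 'a::complex_vector) \<Rightarrow> 'v::complex_vector \<Rightarrow> 'w::complex_vector"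
  assumes "multilinear \<phi>"
  shows "\<exists>!F. clinear F \<and> (\<forall>f v. F (pure f v) = \<phi> f v)"
proof -
  define F0 where "F0 = lin_ext (\<lambda>(f, v). \<phi> f v)"
  have F0: "clinear F0" unfolding F0_def by (rule clinear_lin_ext)
  have F0_pure: "F0 (free_pure f v) = \<phi> f v" for f v
    by (simp add: F0_def free_pure_def scaleC_one)
  have m: "clinear (\<lambda>a. \<phi> (f(i := a)) v)" "clinear (\<phi> f)" for f i v
    using assms by (auto simp: multilinear_def)
  have "x \<in> tensor_relations \<Longrightarrow> F0 x = 0" for x
    unfolding tensor_relations_def
    by (elim UnE CollectE exE) (simp_all add: clinear_diff[OF F0] clinear_scale[OF F0] F0_pure clinear_add[OF m(1)]
        clinear_scale[OF m(1)] clinear_add[OF m(2)] clinear_scale[OF m(2)])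
  then have "F0 x = 0" if "x \<in> complex_vector.span tensor_relations" for x
    using module_hom.eq_0_on_span[OF clinear_module_hom[OF F0] _ that] by blast
  then have rel: "F0 x = F0 y" if "tensor_rel x y" for x y
    using that clinear_diff[OF F0, of x y] unfolding tensor_rel_def by auto
  define F where "F T = F0 (rep_tensor T)" for T :: "('i, 'a, 'v) tensor"
  have F_abs: "F (abs_tensor x) = F0 x" for x
    unfolding F_def by (rule rel) (rule Quotient3_rep_abs[OF Quotient3_tensor], simp add: tensor_rel_def complex_vector.span_zero)
  have "clinear F"
  proof (rule clinearI)
    fix S T :: "('i, 'a, 'v) tensor"
    obtain x y where "S = abs_tensor x" "T = abs_tensor y" by (metis abs_tensor_surj)
    then show "F (S + T) = F S + F T"
      by (simp add: F_abs clinear_add[OF F0] flip: abs_tensor_add)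
  next
    fix c and T :: "('i, 'a, 'v) tensor"
    obtain x where "T = abs_tensor x" by (metis abs_tensor_surj)
    then show "F (c *\<^sub>C T) = c *\<^sub>C F T"
      by (simp add: F_abs clinear_scale[OF F0] flip: abs_tensor_scaleC)
  qed
  moreover have "F (pure f v) = \<phi> f v" for f v
    by (simp add: pure.abs_eq F_abs F0_pure)
  moreover have "F' = F" if "clinear F'" "\<forall>f v. F' (pure f v) = \<phi> f v" for F'
    by (rule ext, rule tensor_linear_eqI) (use that calculation in simp_all)
  ultimately show ?thesis by blast
qed

lemma
  assumes "multilinear \<phi>"
  shows clinear_tensor_lift: "clinear (tensor_lift \<phi>)"
    and tensor_lift_pure: "tensor_lift \<phi> (pure f v) = \<phi> f v"
  using theI'[OF tensor_lift_unique_ex[OF assms]] unfolding tensor_lift_def by auto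

lemma multilinear_tensor_act:
  fixes A :: "'i::finite \<Rightarrow> 'g \<Rightarrow> 'a::complex_vector \<Rightarrow> 'a" and B :: "'g \<Rightarrow> 'v::complex_vector \<Rightarrow> 'v"
  assumes A: "\<And>i. clinear (A i x)" and B: "clinear (B x)"
  shows "multilinear (\<lambda>f v. (\<Sum>i\<in>UNIV. pure (f(i := A i x (f i))) v) + pure f (B x v))"
proof -
  have m: "clinear (\<lambda>a. pure (f(i := a)) v)" "clinear (pure f)"
    for f :: "'i \<Rightarrow> 'a" and i and v :: 'v
    using multilinear_pure by (auto simp: multilinear_def)
  have upd: "clinear (\<lambda>a. pure ((f(j := a))(i := A i x ((f(j := a)) i))) v)"
    for f i j and v :: 'v
  proof (cases "i = j")
    case True
    then show ?thesis
      by (intro clinearI) (simp_all add: clinear_add[OF A] clinear_scale[OF A]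
        clinear_add[OF m(1)] clinear_scale[OF m(1)])
  next
    case False
    then have "(f(j := a))(i := A i x ((f(j := a)) i)) = (f(i := A i x (f i)))(j := a)" for a
      by (auto simp: fun_eq_iff)
    then show ?thesis using m(1) by simp
  qed
  have "clinear (\<lambda>a. (\<Sum>i\<in>UNIV. pure ((f(j := a))(i := A i x ((f(j := a)) i))) v)
      + pure (f(j := a)) (B x v))" for f j and v :: 'v
    by (rule clinearI)
      (simp_all only: clinear_add[OF upd] clinear_scale[OF upd] clinear_add[OF m(1)]
        clinear_scale[OF m(1)] sum.distrib complex_vector.scale_sum_right scaleC_add_right add_ac)
  moreover have "clinear (\<lambda>v. (\<Sum>i\<in>UNIV. pure (f(i := A i x (f i))) v) + pure f (B x v))"
    for f :: "'i \<Rightarrow> 'a"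
    by (rule clinearI)
      (simp_all only: clinear_add[OF B] clinear_scale[OF B] clinear_add[OF m(2)]
        clinear_scale[OF m(2)] sum.distrib complex_vector.scale_sum_right scaleC_add_right add_ac)
  ultimately show ?thesis
    unfolding multilinear_def by blast
qed

lemma
  assumes "\<And>i. clinear (A i x)" and "clinear (B x)"
  shows clinear_tensor_act: "clinear (tensor_act A B x)"
    and tensor_act_pure: "tensor_act A B x (pure f v) =
      (\<Sum>i\<in>UNIV. pure (f(i := A i x (f i))) v) + pure f (B x v)"
  unfolding tensor_act_def
  by (rule clinear_tensor_lift tensor_lift_pure; rule multilinear_tensor_act; fact assms)+


section \<open>The Lie algebra and module axioms\<close>

lemma clinear_lin_ext_param:
  assumes "\<And>b. clinear (\<lambda>y. g b y)"
  shows "clinear (\<lambda>y. lin_ext (\<lambda>b. g b y) x)"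
  by (rule clinearI)
    (simp_all add: lin_ext_def clinear_add[OF assms] clinear_scale[OF assms] scaleC_add_right
      sum.distrib complex_vector.scale_sum_right scaleC_scaleC mult.commute)

lemma clinear_bms_bracket: "clinear (bms_bracket x)" "clinear (\<lambda>x. bms_bracket x y)"
  unfolding bms_bracket_def
  by (rule clinear_lin_ext_param clinear_lin_ext)+

lemma bms_bracket_single [simp]:
  "bms_bracket (Poly_Mapping.single a 1) (Poly_Mapping.single b 1) = bms_basis_bracket a b"
  by (simp add: bms_bracket_def scaleC_one)

lemma bms_bracket_skew: "bms_bracket x y = - bms_bracket y x"
proof -
  have basis: "bms_basis_bracket a b = - bms_basis_bracket b a" for a b
    by (cases a; cases b) (simp_all add: add.commute flip: complex_vector.scale_minus_left)
  have 1: "bms_bracket (Poly_Mapping.single a 1) y = - bms_bracket y (Poly_Mapping.single a 1)" for a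
    by (rule clinear_free_eqI[where x = y])
      (auto intro!: clinearI simp: clinear_add[OF clinear_bms_bracket(1)] clinear_scale[OF clinear_bms_bracket(1)]
       clinear_add[OF clinear_bms_bracket(2)] clinear_scale[OF clinear_bms_bracket(2)] basis[symmetric])
  show ?thesis
    by (rule clinear_free_eqI[where x = x])
      (auto intro!: clinearI simp: clinear_add[OF clinear_bms_bracket(1)] clinear_scale[OF clinear_bms_bracket(1)]
       clinear_add[OF clinear_bms_bracket(2)] clinear_scale[OF clinear_bms_bracket(2)] 1)
qed

lemma lie_algebra_bms: "lie_algebra bms_bracket"
proof -
  note lin = clinear_add[OF clinear_bms_bracket(1)] clinear_scale[OF clinear_bms_bracket(1)]
       clinear_add[OF clinear_bms_bracket(2)] clinear_scale[OF clinear_bms_bracket(2)]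
       clinear_neg[OF clinear_bms_bracket(1)] clinear_0[OF clinear_bms_bracket(1)]
  let ?J = "\<lambda>x y z. bms_bracket x (bms_bracket y z) + bms_bracket y (bms_bracket z x)
     + bms_bracket z (bms_bracket x y)"
  let ?s = "\<lambda>a. Poly_Mapping.single a (1::complex)"
  have basis: "?J (?s a) (?s b) (?s c) = 0" for a b c
    by (cases a; cases b; cases c)
      (simp_all add: lin scaleC_scaleC ac_simps flip: complex_vector.scale_minus_left scaleC_add_left,
       simp_all add: algebra_simps)
  have zero: "clinear (\<lambda>_. 0 :: bms)" by (rule clinearI) simp_all
  have l1: "clinear (\<lambda>x. ?J x y z)" for y z by (rule clinearI) (simp_all add: lin algebra_simps)
  have l2: "clinear (\<lambda>y. ?J x y z)" for x z by (rule clinearI) (simp_all add: lin algebra_simps)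
  have l3: "clinear (\<lambda>z. ?J x y z)" for x y by (rule clinearI) (simp_all add: lin algebra_simps)
  have J1: "?J (?s a) (?s b) z = 0" for a b z by (rule clinear_free_eqI[OF l3 zero]) (rule basis)
  have J2: "?J (?s a) y z = 0" for a y z by (rule clinear_free_eqI[OF l2 zero]) (rule J1)
  have J3: "?J x y z = 0" for x y z by (rule clinear_free_eqI[OF l1 zero]) (rule J2)
  have "bms_bracket x x = 0" for x
  proof -
    have "bms_bracket x x + bms_bracket x x = 0" 
      by (subst (1) bms_bracket_skew) simp
    then have "2 *\<^sub>C bms_bracket x x = 0"
      using scaleC_add_left[of 1 1 "bms_bracket x x"] by (simp add: scaleC_one)
    then show ?thesis by (simp add: complex_vector.scale_eq_0_iff)
  qed
  then show ?thesis unfolding lie_algebra_def using J3 clinear_bms_bracket by auto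
qed

lemma shift_s_simps [simp]:
  "shift_s n (f + g) = shift_s n f + shift_s n g"
  "shift_s n (f - g) = shift_s n f - shift_s n g"
  "shift_s n (f * g) = shift_s n f * shift_s n g"
  "shift_s n [:p:] = [:p:]"
  "shift_s n [:0, 1:] = [:0, 1:] - [:[:of_int n:]:]"
  by (simp_all add: shift_s_def pcompose_add pcompose_diff pcompose_mult pcompose_pCons of_int_poly)

lemma shift_s_shift_s [simp]: "shift_s m (shift_s n f) = shift_s (m + n) f"
proof -
  have "pcompose [:- of_int n, 1:] [:- of_int m, 1:] = ([:- of_int (m + n), 1:] :: complex poly poly)"
    by (simp add: pcompose_pCons)
  then show ?thesis by (simp add: shift_s_def flip: pcompose_assoc)
qed

lemma coeff_deriv_t [simp]: "coeff (deriv_t f) n = pderiv (coeff f n)"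
  by (simp add: deriv_t_def coeff_map_poly)

lemma deriv_t_simps [simp]:
  "deriv_t (f + g) = deriv_t f + deriv_t g"
  "deriv_t (f - g) = deriv_t f - deriv_t g"
  "deriv_t (f * g) = deriv_t f * g + f * deriv_t g"
  "deriv_t [:p:] = [:pderiv p:]"
  "deriv_t [:0, 1:] = 0"
proof -
  have pderiv_sum: "pderiv (\<Sum>i\<in>I. p i) = (\<Sum>i\<in>I. pderiv (p i))" for I :: "nat set" and p :: "nat \<Rightarrow> complex poly"
    by (induction I rule: infinite_finite_induct) (simp_all add: pderiv_add)
  show "deriv_t (f * g) = deriv_t f * g + f * deriv_t g"
  proof (rule poly_eqI)
    fix n
    have "coeff (deriv_t (f * g)) n = (\<Sum>i\<le>n. coeff f i * pderiv (coeff g (n - i))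
        + pderiv (coeff f i) * coeff g (n - i))"
      by (simp add: coeff_mult pderiv_sum pderiv_mult mult.commute)
    then show "coeff (deriv_t (f * g)) n = coeff (deriv_t f * g + f * deriv_t g) n"
      by (simp add: coeff_mult sum.distrib)
  qed
qed (auto simp: poly_eq_iff[of "_ :: complex poly poly"] pderiv_add pderiv_diff coeff_pCons pderiv_1 split: nat.split)

lemma deriv_t_shift_s: "deriv_t (shift_s n f) = shift_s n (deriv_t f)"
proof (induction f)
  case 0
  then show ?case by (simp add: shift_s_def deriv_t_def)
next
  case (pCons a f)
  have e: "pCons a f = [:a:] + [:0, 1:] * f" by simp
  show ?case unfolding e by (simp add: pCons.IH pderiv_diff algebra_simps del: mult_pCons_left mult_pCons_right add_pCons diff_pCons)
qed

lemma phi_H_mult: "[:- \<alpha>, 1:] * phi_H \<alpha> h = h - [:poly h \<alpha>:]"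
  unfolding phi_H_def by (rule dvd_mult_div_cancel) (simp add: dvd_iff_poly_eq_0)

lemma shift_s_0 [simp]: "shift_s n 0 = 0"
  by (simp add: shift_s_def)

lemma deriv_t_0 [simp]: "deriv_t 0 = 0"
  by (simp add: deriv_t_def)

lemma clinear_shift_s: "clinear (shift_s n)"
  by (rule clinearI) (simp_all add: scaleC_poly_poly_eq_smult shift_s_def pcompose_add pcompose_smult)

lemma clinear_deriv_t: "clinear deriv_t"
  by (rule clinearI)
    (auto simp: poly_eq_iff[of "_ :: complex poly poly"] pderiv_add scaleC_poly_eq_smult pderiv_smult)

lemma scaleC_mult_right: "p * (c *\<^sub>C q) = c *\<^sub>C (p * q)" for p q :: "complex poly poly"
  by (simp add: scaleC_poly_poly_eq_smult)

lemma scaleC_mult_left: "(c *\<^sub>C q) * p = c *\<^sub>C (q * p)" for p q :: "complex poly poly"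
  by (simp add: scaleC_poly_poly_eq_smult)

lemma clinear_phi_basis: "clinear (phi_basis lam \<alpha> \<beta> \<gamma> h b)"
  by (cases b; rule clinearI)
    (simp_all add: clinear_scale[OF clinear_shift_s] clinear_scale[OF clinear_deriv_t] scaleC_mult_right scaleC_mult_left
      algebra_simps scaleC_add_right complex_vector.scale_right_diff_distrib scaleC_scaleC
      del: mult_pCons_left mult_pCons_right add_pCons)

lemma clinear_phi_act:
  "clinear (phi_act lam \<alpha> \<beta> \<gamma> h x)" "clinear (\<lambda>x. phi_act lam \<alpha> \<beta> \<gamma> h x f)"
  unfolding phi_act_def[abs_def]
  by (rule clinear_lin_ext_param clinear_lin_ext clinear_phi_basis)+

lemma phi_basis_bracket:
  assumes "lam \<noteq> 0"
  shows "lin_ext (\<lambda>c. phi_basis lam \<alpha> \<beta> \<gamma> h c f) (bms_basis_bracket a b)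
    = phi_basis lam \<alpha> \<beta> \<gamma> h a (phi_basis lam \<alpha> \<beta> \<gamma> h b f)
    - phi_basis lam \<alpha> \<beta> \<gamma> h b (phi_basis lam \<alpha> \<beta> \<gamma> h a f)"
proof -
  define k where "k c = [:[:c:]:]" for c :: complex
  define X :: "complex poly poly" where "X = [:0, 1:]"
  define T :: "complex poly poly" where "T = [:[:0, 1:]:]"
  define H where "H = [:phi_H \<alpha> h:]"
  define H' where "H' = deriv_t H"
  define A B G K where "A = k \<alpha>" and "B = k \<beta>" and "G = k \<gamma>" and "K = k (poly h \<alpha>)"
  define e where "e n = k (lam powi n)" for n
  define N where "N n = k (of_int n)" for n
  let ?S = shift_s and ?D = deriv_t
  have k_add: "k (a + b) = k a + k b" and k_diff: "k (a - b) = k a - k b"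
    and k_mult: "k (a * b) = k a * k b" and k_neg: "k (- a) = - k a" for a b
    by (simp_all add: k_def)
  have sc: "c *\<^sub>C p = k c * p" for c and p :: "complex poly poly"
    by (simp add: k_def scaleC_poly_poly_eq_smult)
  have h: "[:h:] = (T - A) * H + K"
    using phi_H_mult[of \<alpha> h] by (simp add: T_def A_def k_def H_def K_def)
  have t: "[:[:- of_int n * \<alpha>, 1:]:] = T - N n * A" for n
    by (simp add: T_def N_def A_def k_def)
  have hn: "[:phi_h \<alpha> h n:] = N n * ((T - A) * H + K) - N n * (N n - 1) * A * H" for n
    unfolding h[symmetric] phi_h_def
    by (simp add: H_def N_def A_def k_def one_pCons algebra_simps)
  have g: "[:[:\<gamma>:] - smult (of_int n * \<beta>) (phi_H \<alpha> h):] = G - N n * B * H" for n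
    by (simp add: G_def H_def N_def B_def k_def)
  have e_add: "e (m + n) = e m * e n" for m n
    by (simp add: e_def power_int_add assms k_mult)
  have N_simps: "N (m + n) = N m + N n" "N (m - n) = N m - N n" "N (- n) = - N n" for m n
    by (simp_all add: N_def k_add k_diff k_neg)
  have S: "?S n X = X - N n" "?S n T = T" "?S n (k c) = k c" "?S n H = H" "?S n H' = H'"
    "?S n (e m) = e m" "?S n (N m) = N m" "?S n A = A" "?S n B = B" "?S n G = G" "?S n K = K" "?S n 1 = 1" for n m c
    using shift_s_simps(4)[of n 1] shift_s_simps(5)[of n]
    by (simp_all add: X_def N_def k_def T_def H_def e_def A_def B_def G_def K_def H'_def one_pCons)
  have D: "?D X = 0" "?D T = 1" "?D (k c) = 0" "?D H = H'"
    "?D (e m) = 0" "?D (N m) = 0" "?D A = 0" "?D B = 0" "?D G = 0" "?D K = 0" "?D 1 = 0" for m c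
    using deriv_t_simps(4)[of 1] deriv_t_simps(5)
    by (simp_all add: X_def N_def k_def T_def H_def e_def A_def B_def G_def K_def H'_def pderiv_pCons one_pCons)
  have phi: "phi_basis lam \<alpha> \<beta> \<gamma> h (Lb n) f = e n * ((X + (N n * ((T - A) * H + K) - N n * (N n - 1) * A * H)) * ?S n f)
      - N n * e n * ((T - N n * A) * ?S n (?D f))"
    "phi_basis lam \<alpha> \<beta> \<gamma> h (Wb n) f = e n * ((T - N n * A) * ?S n f)"
    "phi_basis lam \<alpha> \<beta> \<gamma> h (Ib n) f = e n * ((G - N n * B * H) * ?S n f) + N n * e n * B * ?S n (?D f)"
    "phi_basis lam \<alpha> \<beta> \<gamma> h (Jb n) f = e n * B * ?S n f" for n f
    unfolding phi_basis.simps sc k_mult t hn g X_def[symmetric] deriv_t_shift_s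
    by (simp_all add: N_def e_def B_def)
  have le0: "lin_ext \<phi> (0 :: bms) = 0" for \<phi> :: "_ \<Rightarrow> complex poly poly"
    by (simp add: lin_ext_def)
  have k1: "k 1 = 1" by (simp add: k_def one_pCons)
  have kN: "k (of_int m) = N m" for m by (simp add: N_def)
  show ?thesis
    by (cases a; cases b)
      (simp_all only: bms_basis_bracket.simps clinear_scale[OF clinear_lin_ext] clinear_neg[OF clinear_lin_ext]
        lin_ext_single complex_vector.scale_one le0 phi sc k_neg kN k1 mult_1
        shift_s_simps(1,2,3) deriv_t_simps(1,2,3) S D shift_s_shift_s deriv_t_shift_s e_add N_simps add.commute[of _ "_::int"],
       simp_all add: algebra_simps)
qed

lemma lie_module_phi_act:
  assumes "lam \<noteq> 0"
  shows "lie_module bms_bracket (phi_act lam \<alpha> \<beta> \<gamma> h)"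
proof -
  let ?a = "phi_act lam \<alpha> \<beta> \<gamma> h"
  let ?s = "\<lambda>a. Poly_Mapping.single a (1::complex)"
  note lin = clinear_add[OF clinear_bms_bracket(1)] clinear_scale[OF clinear_bms_bracket(1)]
    clinear_add[OF clinear_bms_bracket(2)] clinear_scale[OF clinear_bms_bracket(2)]
    clinear_add[OF clinear_phi_act(1)] clinear_scale[OF clinear_phi_act(1)]
    clinear_add[OF clinear_phi_act(2)] clinear_scale[OF clinear_phi_act(2)]
    complex_vector.scale_right_diff_distrib
  have basis: "?a (bms_bracket (?s a) (?s b)) f = ?a (?s a) (?a (?s b) f) - ?a (?s b) (?a (?s a) f)"
    for a b f
    using phi_basis_bracket[OF assms, of \<alpha> \<beta> \<gamma> h f a b]
    by (simp add: phi_act_def scaleC_one)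
  have l1: "clinear (\<lambda>x. ?a (bms_bracket x y) f)"
    "clinear (\<lambda>x. ?a x (?a y f) - ?a y (?a x f))" for y f
    by (rule clinearI; simp add: lin)+
  have l2: "clinear (\<lambda>y. ?a (bms_bracket x y) f)"
    "clinear (\<lambda>y. ?a x (?a y f) - ?a y (?a x f))" for x f
    by (rule clinearI; simp add: lin)+
  have "?a (bms_bracket (?s a) y) f = ?a (?s a) (?a y f) - ?a y (?a (?s a) f)" for a y f
    by (rule clinear_free_eqI[OF l2]) (rule basis)
  then have "?a (bms_bracket x y) f = ?a x (?a y f) - ?a y (?a x f)" for x y f
    by (rule clinear_free_eqI[OF l1])
  then show ?thesis
    unfolding lie_module_def using clinear_phi_act by blast
qed

lemma lie_module_tensor_act:
  fixes A :: "'i::finite \<Rightarrow> 'g::complex_vector \<Rightarrow> 'a::complex_vector \<Rightarrow> 'a"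
    and B :: "'g \<Rightarrow> 'v::complex_vector \<Rightarrow> 'v"
  assumes A: "\<And>i. lie_module br (A i)" and B: "lie_module br B"
  shows "lie_module br (tensor_act A B)"
proof -
  have A1: "clinear (A i x)" and A2: "clinear (\<lambda>x. A i x a)"
    and A3: "A i (br x y) a = A i x (A i y a) - A i y (A i x a)" for i x y a
    using A by (auto simp: lie_module_def)
  have B1: "clinear (B x)" and B2: "clinear (\<lambda>x. B x v)"
    and B3: "B (br x y) v = B x (B y v) - B y (B x v)" for x y v
    using B by (auto simp: lie_module_def)
  have m: "clinear (\<lambda>a. pure (f(i := a)) v)" "clinear (pure f)"
    for f :: "'i \<Rightarrow> 'a" and i and v :: 'v
    using multilinear_pure by (auto simp: multilinear_def)
  note lin = clinear_tensor_act[where A = A and B = B, OF A1 B1]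
  note [simp] = tensor_act_pure[where A = A and B = B, OF A1 B1]
  have x_lin: "clinear (\<lambda>x. tensor_act A B x T)" for T
  proof (rule clinearI)
    fix x y
    show "tensor_act A B (x + y) T = tensor_act A B x T + tensor_act A B y T"
    proof (rule tensor_linear_eqI[OF lin])
      show "clinear (\<lambda>T. tensor_act A B x T + tensor_act A B y T)"
        by (rule clinearI) (simp_all add: clinear_add[OF lin] clinear_scale[OF lin] scaleC_add_right)
    qed (simp add: clinear_add[OF A2] clinear_add[OF B2] clinear_add[OF m(1)] clinear_add[OF m(2)] sum.distrib)
  next
    fix c x
    show "tensor_act A B (c *\<^sub>C x) T = c *\<^sub>C tensor_act A B x T"
    proof (rule tensor_linear_eqI[OF lin])
      show "clinear (\<lambda>T. c *\<^sub>C tensor_act A B x T)"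
        by (rule clinearI) (simp_all add: clinear_add[OF lin] clinear_scale[OF lin] scaleC_add_right scaleC_scaleC mult.commute)
    qed (simp add: clinear_scale[OF A2] clinear_scale[OF B2] clinear_scale[OF m(1)]
        clinear_scale[OF m(2)] scaleC_add_right complex_vector.scale_sum_right)
  qed
  have "tensor_act A B (br x y) T
      = tensor_act A B x (tensor_act A B y T) - tensor_act A B y (tensor_act A B x T)" for x y T
  proof (rule tensor_linear_eqI[OF lin])
    show "clinear (\<lambda>T. tensor_act A B x (tensor_act A B y T) - tensor_act A B y (tensor_act A B x T))"
      by (rule clinearI) (simp_all add: clinear_add[OF lin] clinear_scale[OF lin] complex_vector.scale_right_diff_distrib)
    fix f :: "'i \<Rightarrow> 'a" and v :: 'v
    define g where "g x y i j = pure ((f(i := A i y (f i)))(j := A j x ((f(i := A i y (f i))) j))) v" for x y i j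
    have xy: "tensor_act A B x (tensor_act A B y (pure f v)) =
        (\<Sum>i\<in>UNIV. \<Sum>j\<in>UNIV. g x y i j) + (\<Sum>i\<in>UNIV. pure (f(i := A i y (f i))) (B x v))
        + (\<Sum>i\<in>UNIV. pure (f(i := A i x (f i))) (B y v)) + pure f (B x (B y v))" for x y
      by (simp add: clinear_add[OF lin] clinear_sum[OF lin] g_def sum.distrib add.assoc)
    have g_diff: "g x y i j - g y x j i =
      (if j = i then pure (f(i := A i (br x y) (f i))) v else 0)" for i j
      by (auto simp: g_def A3 clinear_diff[OF m(1)] fun_upd_twist)
    have "(\<Sum>i\<in>UNIV. \<Sum>j\<in>UNIV. g x y i j) - (\<Sum>i\<in>UNIV. \<Sum>j\<in>UNIV. g y x i j)
      = (\<Sum>i\<in>UNIV. \<Sum>j\<in>UNIV. g x y i j) - (\<Sum>i\<in>UNIV. \<Sum>j\<in>UNIV. g y x j i)"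
      by (subst (3) sum.swap) (rule refl)
    also have "\<dots> = (\<Sum>i\<in>UNIV. pure (f(i := A i (br x y) (f i))) v)"
      by (simp add: g_diff flip: sum_subtractf)
    finally have 1: "(\<Sum>i\<in>UNIV. \<Sum>j\<in>UNIV. g x y i j)
      = (\<Sum>i\<in>UNIV. pure (f(i := A i (br x y) (f i))) v) + (\<Sum>i\<in>UNIV. \<Sum>j\<in>UNIV. g y x i j)"
      by (simp add: diff_eq_eq)
    show "tensor_act A B (br x y) (pure f v) = tensor_act A B x (tensor_act A B y (pure f v))
      - tensor_act A B y (tensor_act A B x (pure f v))"
      unfolding xy 1 by (simp add: B3 clinear_diff[OF m(2)])
  qed
  then show ?thesis
    unfolding lie_module_def using lin x_lin by blast
qed

end

theory Submission
  imports Defs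
begin

text \<open>
  If \<open>\<lambda>\<^sub>i = \<lambda>\<^sub>j\<close> for some \<open>i \<noteq> j\<close>, the tensors whose polynomials depend on \<open>s\<^sub>i\<close> and \<open>s\<^sub>j\<close> only
  through \<open>s\<^sub>i + s\<^sub>j\<close> form a proper nonzero submodule.

  Suppose the \<open>\<lambda>\<^sub>i\<close> are distinct and let \<open>U\<close> be a nonzero submodule. On a given vector, \<open>X\<^sub>n\<close>
  with \<open>X \<in> {L, W, I, J}\<close> and \<open>n\<close> large kills the factor \<open>V\<close>, so it acts by
  \<open>\<Sum>\<^sub>i \<lambda>\<^sub>i\<^sup>n P\<^sub>i(n)\<close> with \<open>P\<^sub>i\<close> polynomial in \<open>n\<close>. Linear independence of the functions
  \<open>\<lambda>\<^sub>i\<^sup>n n\<^sup>m\<close> puts every coefficient of every \<open>P\<^sub>i\<close> into \<open>U\<close>. The coefficient operators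
  generate the whole Weyl algebra in \<open>s\<^sub>i, t\<^sub>i\<close> because \<open>\<alpha>\<^sub>i \<noteq> 0\<close> or \<open>\<beta>\<^sub>i \<noteq> 0\<close>.
  Differentiating as long as possible yields \<open>1 \<otimes> v \<in> U\<close> with \<open>v \<noteq> 0\<close>; the set of all such \<open>v\<close>
  is a submodule of \<open>V\<close>, hence \<open>V\<close> itself, and multiplications then produce every tensor.
\<close>

section \<open>Linear maps\<close>

lemma clinear_compose: "clinear f \<Longrightarrow> clinear g \<Longrightarrow> clinear (\<lambda>x. f (g x))"
  by (rule clinearI) (simp_all add: clinear_add clinear_scale)

lemma clinear_id: "clinear (\<lambda>x. x)"
  by (rule clinearI) simp_all

lemma clinear_zero: "clinear (\<lambda>x. 0)"
  by (rule clinearI) simp_all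

lemma clinear_plus: "clinear f \<Longrightarrow> clinear g \<Longrightarrow> clinear (\<lambda>x. f x + g x)"
  by (rule clinearI) (simp_all add: clinear_add clinear_scale scaleC_add_right)

lemma clinear_minus: "clinear f \<Longrightarrow> clinear g \<Longrightarrow> clinear (\<lambda>x. f x - g x)"
  by (rule clinearI)
    (simp_all add: clinear_add clinear_scale complex_vector.scale_right_diff_distrib)

lemma clinear_scaleC: "clinear f \<Longrightarrow> clinear (\<lambda>x. c *\<^sub>C f x)"
  by (rule clinearI) (simp_all add: clinear_add clinear_scale scaleC_add_right scaleC_scaleC mult.commute)

lemma clinear_sum_fun: "(\<And>k. k \<in> K \<Longrightarrow> clinear (f k)) \<Longrightarrow> clinear (\<lambda>x. \<Sum>k\<in>K. f k x)"
  by (rule clinearI) (simp_all add: clinear_add clinear_scale sum.distrib complex_vector.scale_sum_right)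

lemma clinear_funpow:
  fixes f :: "'a::complex_vector \<Rightarrow> 'a"
  shows "clinear f \<Longrightarrow> clinear (f ^^ n)"
proof (induction n)
  case 0
  have "f ^^ 0 = (\<lambda>x. x)" by (simp add: fun_eq_iff)
  then show ?case by (simp only: clinear_id)
next
  case (Suc n)
  have "f ^^ Suc n = (\<lambda>x. f ((f ^^ n) x))" by (simp add: fun_eq_iff)
  then show ?case using clinear_compose[OF Suc.prems Suc.IH[OF Suc.prems]] by (simp only:)
qed

lemma clinear_times: "clinear ((*) p)" for p :: "complex poly poly"
  by (rule clinearI) (simp_all add: scaleC_mult_right algebra_simps)

lemma clinear_pderiv: "clinear (pderiv :: complex poly poly \<Rightarrow> _)"
  by (rule clinearI) (simp_all add: pderiv_add scaleC_poly_poly_eq_smult pderiv_smult)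

lemmas clinear_intros = clinear_id clinear_zero clinear_plus clinear_minus clinear_scaleC
  clinear_sum_fun clinear_times clinear_pderiv clinear_shift_s clinear_deriv_t

text \<open>A basis of \<open>U\<close> stays independent after adding \<open>w\<close>, so a
  functional can be prescribed on the enlarged set. Such functionals reduce membership in
  \<open>U\<close> to the vanishing of scalar expressions.\<close>

lemma separating_functional:
  assumes "complex_vector.subspace U" "w \<notin> U"
  obtains \<phi> :: "'v::complex_vector \<Rightarrow> complex"
  where "clinear \<phi>" "\<And>u. u \<in> U \<Longrightarrow> \<phi> u = 0" "\<phi> w = 1"
proof -
  obtain B where B: "B \<subseteq> U" "complex_vector.independent B" "U \<subseteq> complex_vector.span B"
    by (rule complex_vector.maximal_independent_subset)
  have sp: "complex_vector.span B \<subseteq> U"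
    using B(1) assms(1) by (simp add: complex_vector.span_minimal)
  then have ind: "complex_vector.independent (insert w B)"
    using B assms(2) by (intro complex_vector.independent_insertI) auto
  have "vector_space_pair (scaleC :: complex \<Rightarrow> 'v \<Rightarrow> 'v) (scaleC :: complex \<Rightarrow> complex \<Rightarrow> complex)"
    by (intro vector_space_pair.intro complex_vector.vector_space_axioms)
  from vector_space_pair.linear_independent_extend[OF this ind, of "\<lambda>x. if x = w then 1 else 0"]
  obtain \<phi> :: "'v \<Rightarrow> complex"
    where \<phi>: "clinear \<phi>" "\<forall>x\<in>insert w B. \<phi> x = (if x = w then 1 else 0)"
    by blast
  have "w \<notin> B" using B(1) assms(2) by blast
  then have "\<phi> x = 0" if "x \<in> B" for x using \<phi>(2) that by auto
  then have zero: "\<phi> u = 0" if "u \<in> U" for u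
    using module_hom.eq_0_on_span[OF clinear_module_hom[OF \<phi>(1)]] B(3) that by blast
  show ?thesis by (rule that[OF \<phi>(1) zero]) (use \<phi>(2) in auto)
qed

section \<open>Exponential polynomials\<close>

text \<open>Passing from a sequence \<open>F n\<close> to \<open>F (n + 1) - lam a * F n\<close>
  lowers the degree of \<open>p a\<close> and keeps the degrees of the other \<open>p i\<close>,
  because \<open>lam i\<close> differs from \<open>lam a\<close>. Repetition removes the index
  \<open>a\<close>.\<close>

lemma exp_poly_eq_0:
  fixes lam :: "'i \<Rightarrow> complex"
  assumes "finite I" "inj_on lam I" "\<And>i. i \<in> I \<Longrightarrow> lam i \<noteq> 0"
    and "\<And>n. n \<ge> M \<Longrightarrow> (\<Sum>i\<in>I. lam i ^ n * poly (p i) (of_nat n)) = 0"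
    and "i \<in> I"
  shows "p i = 0"
  using assms
proof (induction I arbitrary: p i rule: finite_induct)
  case empty
  then show ?case by simp
next
  case (insert a I)
  \<comment> \<open>\<open>d\<close> strictly bounds the degree of a nonzero \<open>p a\<close>, so
    at \<open>d = 0\<close> the index \<open>a\<close> drops out and the induction hypothesis for
    \<open>I\<close> applies.\<close>
  have *: "\<forall>i\<in>insert a I. p i = 0"
    if "\<And>n. n \<ge> M \<Longrightarrow> (\<Sum>i\<in>insert a I. lam i ^ n * poly (p i) (of_nat n)) = 0" 
       "p a \<noteq> 0 \<Longrightarrow> degree (p a) < d" for p d
    using that
  proof (induction d arbitrary: p)
    case 0
    then have a: "p a = 0" by auto
    have "p i = 0" if "i \<in> I" for i
    proof (rule insert.IH[OF _ _ _ that])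
      show "inj_on lam I" using insert.prems(1) by simp
      show "lam i \<noteq> 0" if "i \<in> I" for i using insert.prems(2) that by simp
      show "(\<Sum>i\<in>I. lam i ^ n * poly (p i) (of_nat n)) = 0" if "n \<ge> M" for n
        using 0(1)[OF that] a insert.hyps by simp
    qed
    with a show ?case by auto
  next
    case (Suc d)
    \<comment> \<open>These are the polynomials belonging to \<open>F (n + 1) - lam a * F n\<close>.
      Leading terms cancel for \<open>i = a\<close>, but not for a nonzero \<open>p i\<close> with
      \<open>i\<close> in \<open>I\<close>.\<close>
    define q where "q i = smult (lam i) (pcompose (p i) [:1, 1:]) - smult (lam a) (p i)" for i
    have lead: "coeff (pcompose (p i) [:1, 1:]) (degree (p i)) = lead_coeff (p i)" for i
      using lead_coeff_comp[of "[:1, 1 :: complex:]" "p i"] by (simp add: degree_pcompose)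
    have "(\<Sum>i\<in>insert a I. lam i ^ n * poly (q i) (of_nat n)) = 0" if "n \<ge> M" for n
    proof -
      have "(\<Sum>i\<in>insert a I. lam i ^ n * poly (q i) (of_nat n)) =
        (\<Sum>i\<in>insert a I. lam i ^ Suc n * poly (p i) (of_nat (Suc n)))
        - lam a * (\<Sum>i\<in>insert a I. lam i ^ n * poly (p i) (of_nat n))"
        unfolding sum_distrib_left sum_subtractf[symmetric]
        by (intro sum.cong) (simp_all add: q_def poly_pcompose algebra_simps)
      also have "\<dots> = 0"
        using Suc.prems(1)[of n] Suc.prems(1)[of "Suc n"] that by (simp only: le_SucI mult_zero_right diff_zero)
      finally show ?thesis .
    qed
    moreover have "degree (q a) < d" if "q a \<noteq> 0"
    proof -
      have "degree (q a) \<le> degree (p a)"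
        unfolding q_def by (intro degree_diff_le order.trans[OF degree_smult_le]) (simp_all add: degree_pcompose)
      moreover have "coeff (q a) (degree (p a)) = 0"
        by (simp add: q_def lead)
      ultimately have "degree (q a) < degree (p a)"
        using that by (metis leading_coeff_0_iff order_le_less)
      then show ?thesis using Suc.prems(2) by force
    qed
    ultimately have q: "\<forall>i\<in>insert a I. q i = 0" by (rule Suc.IH)
    have I: "p i = 0" if "i \<in> I" for i
    proof -
      have "coeff (q i) (degree (p i)) = 0" using q that by simp
      then have "(lam i - lam a) * lead_coeff (p i) = 0" by (simp add: q_def lead algebra_simps)
      moreover have "lam i \<noteq> lam a" using insert.hyps insert.prems(1) that by (metis imageI inj_on_insert insert_Diff_single Diff_insert_absorb)
      ultimately show ?thesis by simp
    qed
    \<comment> \<open>Only the term of \<open>a\<close> survives, so \<open>p a\<close> has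
      infinitely many roots.\<close>
    have "poly (p a) (of_nat n) = 0" if "n \<ge> M" for n
      using Suc.prems(1)[OF that] insert.hyps insert.prems(2)[of a] by (simp add: I)
    then have "of_nat ` {M..} \<subseteq> {x. poly (p a) x = 0}" by auto
    moreover have "infinite (of_nat ` {M..} :: complex set)"
      by (auto dest!: finite_imageD simp: inj_on_def infinite_Ici)
    ultimately have "p a = 0" using poly_roots_finite finite_subset by blast
    with I show ?case by auto
  qed
  show ?case
    using *[OF insert.prems(3) lessI] insert.prems(4) by blast
qed

text \<open>Two powers of n are kept apart: \<open>k\<close> comes from the formula of the action,
  \<open>j\<close> from the Taylor expansion of the shift. The sum in the conclusion is the
  coefficient of \<open>n ^ m\<close> next to \<open>lam i ^ n\<close>. If it were outside
  \<open>U\<close>, a functional vanishing on \<open>U\<close> would contradict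
  \<open>exp_poly_eq_0\<close>.\<close>

lemma exp_poly_coeff_mem:
  fixes lam :: "'i \<Rightarrow> complex" and a :: "'i \<Rightarrow> nat \<Rightarrow> nat \<Rightarrow> 'v::complex_vector"
  assumes U: "complex_vector.subspace U"
    and lam: "finite I" "inj_on lam I" "\<And>i. i \<in> I \<Longrightarrow> lam i \<noteq> 0"
    and mem: "\<And>n. n \<ge> M \<Longrightarrow>
      (\<Sum>i\<in>I. lam i ^ n *\<^sub>C (\<Sum>k<K. of_nat n ^ k *\<^sub>C (\<Sum>j<N. of_nat n ^ j *\<^sub>C a i k j))) \<in> U"
    and N: "\<And>i k j. j \<ge> N \<Longrightarrow> a i k j = 0"
    and i: "i \<in> I"
  shows "(\<Sum>k<K. if m < k then 0 else a i k (m - k)) \<in> U"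
proof (rule ccontr)
  assume "\<not> ?thesis"
  then obtain \<phi> :: "'v \<Rightarrow> complex" where \<phi>: "clinear \<phi>" "\<And>u. u \<in> U \<Longrightarrow> \<phi> u = 0"
    "\<phi> (\<Sum>k<K. if m < k then 0 else a i k (m - k)) = 1"
    using separating_functional[OF U] by blast
  define q where "q i k = (\<Sum>j<N. monom (\<phi> (a i k j)) j)" for i k
  define p where "p i = (\<Sum>k<K. monom 1 k * q i k)" for i
  \<comment> \<open>The vanishing of \<open>a i k j\<close> for \<open>j \<ge> N\<close> makes this
    hold for every \<open>j\<close>.\<close>
  have q: "coeff (q i k) j = \<phi> (a i k j)" for i k j
    using N[of j i k] clinear_0[OF \<phi>(1)] by (cases "j < N") (auto simp: q_def coeff_sum)
  have "p i = 0"
  proof (rule exp_poly_eq_0[OF lam _ i])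
    fix n assume "n \<ge> M"
    from \<phi>(2)[OF mem[OF this]]
    show "(\<Sum>i\<in>I. lam i ^ n * poly (p i) (of_nat n)) = 0"
      by (simp add: clinear_sum[OF \<phi>(1)] clinear_scale[OF \<phi>(1)] scaleC_complex_def
          p_def q_def poly_sum poly_monom sum_distrib_left mult_ac)
  qed
  then have "0 = coeff (p i) m" by simp
  also have "\<dots> = (\<Sum>k<K. if m < k then 0 else \<phi> (a i k (m - k)))"
    by (simp add: p_def coeff_sum coeff_monom_mult q del: if_split cong: if_cong)
  also have "\<dots> = \<phi> (\<Sum>k<K. if m < k then 0 else a i k (m - k))"
    unfolding clinear_sum[OF \<phi>(1)] by (intro sum.cong) (auto simp: clinear_0[OF \<phi>(1)])
  finally show False using \<phi>(3) by simp
qed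

section \<open>Operators on single tensor factors\<close>

text \<open>Scalars are absorbed into the last factor, so every tensor is a plain sum of pure
  ones.\<close>

lemma pure_induct [case_names pure add]:
  fixes u :: "('i::finite, 'a::complex_vector, 'v::complex_vector) tensor"
  assumes "\<And>f v. P (pure f v)" and "\<And>u w. P u \<Longrightarrow> P w \<Longrightarrow> P (u + w)"
  shows "P u"
proof -
  have m: "clinear (pure f)" for f :: "'i \<Rightarrow> 'a"
    using multilinear_pure by (auto simp: multilinear_def)
  obtain x where u: "u = abs_tensor x" by (rule abs_tensor_surj)
  have P0: "P 0" using assms(1)[of undefined 0] by (simp add: clinear_0[OF m])
  have "P (abs_tensor (\<Sum>b\<in>B. Poly_Mapping.lookup x b *\<^sub>C Poly_Mapping.single b 1))"
    if "finite B" for B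
    using that
  proof (induction B rule: finite_induct)
    case empty
    then show ?case using P0 by (simp add: clinear_0[OF clinear_abs_tensor])
  next
    case (insert b B)
    have "P (abs_tensor (Poly_Mapping.lookup x b *\<^sub>C Poly_Mapping.single b 1))"
      using assms(1)[of "fst b" "Poly_Mapping.lookup x b *\<^sub>C snd b"]
      by (simp add: abs_tensor_scaleC abs_tensor_single clinear_scale[OF m])
    with insert assms(2) show ?case by (simp add: abs_tensor_add)
  qed
  then show ?thesis unfolding u by (subst free_eq_sum) simp
qed

definition slot ::
  "'i \<Rightarrow> ('a \<Rightarrow> 'a) \<Rightarrow> ('i::finite, 'a::complex_vector, 'v::complex_vector) tensor \<Rightarrow> ('i, 'a, 'v) tensor"
  where "slot i A = tensor_lift (\<lambda>f v. pure (f(i := A (f i))) v)"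

definition last_slot ::
  "('v \<Rightarrow> 'v) \<Rightarrow> ('i::finite, 'a::complex_vector, 'v::complex_vector) tensor \<Rightarrow> ('i, 'a, 'v) tensor"
  where "last_slot B = tensor_lift (\<lambda>f v. pure f (B v))"

lemma clinear_pure_upd: "clinear (\<lambda>a. pure (f(i := a)) v)"
  and clinear_pure: "clinear (pure f)"
  using multilinear_pure by (auto simp: multilinear_def)

lemma multilinear_slot:
  fixes A :: "'a::complex_vector \<Rightarrow> 'a" and i :: "'i::finite"
  assumes "clinear A"
  shows "multilinear (\<lambda>f v. pure (f(i := A (f i))) v)"
  unfolding multilinear_def
proof (intro conjI allI)
  fix f :: "'i \<Rightarrow> 'a" and j and v :: "'v::complex_vector"
  show "clinear (\<lambda>a. pure ((f(j := a))(i := A ((f(j := a)) i))) v)"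
  proof (cases "i = j")
    case True
    then show ?thesis using clinear_compose[OF clinear_pure_upd assms] by simp
  next
    case False
    then have "(f(j := a))(i := A ((f(j := a)) i)) = (f(i := A (f i)))(j := a)" for a
      by (auto simp: fun_eq_iff)
    then show ?thesis using clinear_pure_upd by simp
  qed
qed (rule clinear_pure)

lemma multilinear_last_slot:
  assumes "clinear B"
  shows "multilinear (\<lambda>f v. pure f (B v))"
  unfolding multilinear_def
  using clinear_pure_upd clinear_compose[OF clinear_pure assms] by blast

lemma clinear_slot: "clinear A \<Longrightarrow> clinear (slot i A)"
  and slot_pure: "clinear A \<Longrightarrow> slot i A (pure f v) = pure (f(i := A (f i))) v"
  unfolding slot_def
  by (simp_all only: clinear_tensor_lift[OF multilinear_slot] tensor_lift_pure[OF multilinear_slot])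

lemma clinear_last_slot: "clinear B \<Longrightarrow> clinear (last_slot B)"
  and last_slot_pure: "clinear B \<Longrightarrow> last_slot B (pure f v) = pure f (B v)"
  unfolding last_slot_def
  by (simp_all only: clinear_tensor_lift[OF multilinear_last_slot]
      tensor_lift_pure[OF multilinear_last_slot])

lemma slot_compose:
  assumes "clinear A" "clinear B"
  shows "slot i (\<lambda>x. A (B x)) u = slot i A (slot i B u)"
  by (induction u rule: pure_induct)
    (simp_all add: assms slot_pure clinear_compose clinear_add[OF clinear_slot])

lemma slot_commute:
  assumes "clinear A" "clinear B" and "i \<noteq> j \<or> (\<forall>x. A (B x) = B (A x))"
  shows "slot i A (slot j B u) = slot j B (slot i A u)"
proof (induction u rule: pure_induct)
  case (pure f v)
  then show ?case
  proof (cases "i = j")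
    case False
    then show ?thesis by (simp add: assms(1,2) slot_pure fun_upd_twist)
  qed (use assms in \<open>simp add: slot_pure\<close>)
qed (simp add: assms(1,2) clinear_add[OF clinear_slot])

lemma slot_id: "slot i (\<lambda>x. x) u = u"
  by (induction u rule: pure_induct) (simp_all add: clinear_id slot_pure clinear_add[OF clinear_slot])

lemma slot_zero: "slot i (\<lambda>x. 0) u = 0"
  by (induction u rule: pure_induct)
    (simp_all add: clinear_zero slot_pure clinear_add[OF clinear_slot] clinear_0[OF clinear_pure_upd])

lemma slot_plus:
  assumes "clinear A" "clinear B"
  shows "slot i (\<lambda>x. A x + B x) u = slot i A u + slot i B u"
  by (induction u rule: pure_induct)
    (simp_all add: assms slot_pure clinear_plus clinear_add[OF clinear_slot] clinear_add[OF clinear_pure_upd])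

lemma slot_scaleC:
  assumes "clinear A"
  shows "slot i (\<lambda>x. c *\<^sub>C A x) u = c *\<^sub>C slot i A u"
  by (induction u rule: pure_induct)
    (simp_all add: assms slot_pure clinear_scaleC clinear_add[OF clinear_slot]
      clinear_scale[OF clinear_pure_upd] scaleC_add_right)

lemma slot_minus:
  assumes "clinear A" "clinear B"
  shows "slot i (\<lambda>x. A x - B x) u = slot i A u - slot i B u"
  by (induction u rule: pure_induct)
    (simp_all add: assms slot_pure clinear_minus clinear_add[OF clinear_slot] clinear_diff[OF clinear_pure_upd])

lemma slot_sum:
  assumes "finite K" "\<And>k. k \<in> K \<Longrightarrow> clinear (A k)"
  shows "slot i (\<lambda>x. \<Sum>k\<in>K. A k x) u = (\<Sum>k\<in>K. slot i (A k) u)"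
  using assms
  by (induction K rule: finite_induct) (simp_all add: slot_zero slot_plus clinear_sum_fun)

lemma tensor_act_eq_slots:
  assumes "\<And>i. clinear (A i x)" "clinear (B x)"
  shows "tensor_act A B x u = (\<Sum>i\<in>UNIV. slot i (A i x) u) + last_slot (B x) u"
  by (induction u rule: pure_induct)
    (simp_all add: assms tensor_act_pure clinear_add[OF clinear_tensor_act] slot_pure last_slot_pure
      clinear_add[OF clinear_slot] clinear_add[OF clinear_last_slot] sum.distrib)

text \<open>Linear functionals that do not vanish on the \<open>f i\<close>, multiplied together and
  with the identity of the last factor, give a multilinear map that separates
  \<open>pure f v\<close> from 0.\<close>

lemma pure_eq_0_iff:
  fixes f :: "'i::finite \<Rightarrow> complex poly poly" and v :: "'v::complex_vector"
  shows "pure f v = 0 \<longleftrightarrow> (\<exists>i. f i = 0) \<or> v = 0"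
proof
  assume "pure f v = 0"
  show "(\<exists>i. f i = 0) \<or> v = 0"
  proof (rule ccontr)
    assume "\<not> ?thesis"
    then have f: "f i \<noteq> 0" and v: "v \<noteq> 0" for i by auto
    \<comment> \<open>The functional picks the leading coefficient of \<open>f i\<close>, first in s
      and then in t.\<close>
    define c where "c i g = coeff (coeff g (degree (f i))) (degree (lead_coeff (f i)))"
      for i and g :: "complex poly poly"
    have c: "clinear (c i)" for i
      by (rule clinearI) (simp_all add: c_def scaleC_complex_def)
    define \<phi> where "\<phi> g w = (\<Prod>i\<in>UNIV. c i (g i)) *\<^sub>C w" for g and w :: 'v
    have split: "\<phi> g w = c i (g i) *\<^sub>C (\<Prod>j\<in>UNIV - {i}. c j (g j)) *\<^sub>C w" for g w i
      by (simp add: \<phi>_def prod.remove[of UNIV i] scaleC_scaleC)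
    have "multilinear \<phi>"
      unfolding multilinear_def
    proof (intro conjI allI)
      fix g i and w :: 'v
      show "clinear (\<lambda>a. \<phi> (g(i := a)) w)"
        by (rule clinearI)
          (simp_all add: split[of _ _ i] clinear_add[OF c] clinear_scale[OF c] scaleC_add_left
            scaleC_complex_def scaleC_scaleC distrib_right)
      show "clinear (\<phi> g)"
        by (rule clinearI) (simp_all add: \<phi>_def scaleC_add_right scaleC_scaleC mult.commute)
    qed
    from tensor_lift_pure[OF this, of f v] clinear_0[OF clinear_tensor_lift[OF this]]
    have "\<phi> f v = 0" using \<open>pure f v = 0\<close> by simp
    then show False using f v by (simp add: \<phi>_def c_def complex_vector.scale_eq_0_iff)
  qed
next
  assume "(\<exists>i. f i = 0) \<or> v = 0"
  then show "pure f v = 0"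
    using clinear_0[OF clinear_pure_upd] clinear_0[OF clinear_pure] by (metis fun_upd_triv)
qed

section \<open>Taylor expansion of the shift and antiderivatives\<close>

text \<open>\<open>taylor_s j f\<close> is the coefficient of \<open>n ^ j\<close> in \<open>f(s - n, t)\<close>.\<close>

primrec taylor_s :: "nat \<Rightarrow> complex poly poly \<Rightarrow> complex poly poly" where
  "taylor_s 0 f = f"
| "taylor_s (Suc j) f = (- 1 / of_nat (Suc j)) *\<^sub>C pderiv (taylor_s j f)"

lemma clinear_taylor_s: "clinear (taylor_s j)"
proof (induction j)
  case 0
  have "taylor_s 0 = (\<lambda>f. f)" by auto
  then show ?case by (simp only: clinear_id)
next
  case (Suc j)
  have "taylor_s (Suc j) = (\<lambda>f. (- 1 / of_nat (Suc j)) *\<^sub>C pderiv (taylor_s j f))" by auto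
  then show ?case
    using clinear_scaleC[OF clinear_compose[OF clinear_pderiv Suc]] by (simp only:)
qed

lemma pderiv_taylor_s: "pderiv (taylor_s j f) = (- of_nat (Suc j)) *\<^sub>C taylor_s (Suc j) f"
  by (simp add: scaleC_scaleC scaleC_one del: of_nat_Suc)

text \<open>The identity compares coefficients of \<open>n ^ (j + 1)\<close> in (s - n) f(s - n, t).
  As the expansion is itself derived from it, the proof proceeds by differentiating one case to
  reach the next.\<close>

lemma taylor_s_Suc_times:
  "taylor_s (Suc j) ([:0, 1:] * f) = [:0, 1:] * taylor_s (Suc j) f - taylor_s j f"
proof (induction j)
  case 0
  have "pderiv ([:0, 1:] * f) = f + [:0, 1:] * pderiv f"
    unfolding pderiv_mult by (simp add: pderiv_pCons)
  then show ?case 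
    unfolding taylor_s.simps
    by (simp add: scaleC_mult_right scaleC_one del: mult_pCons_left)
next
  case (Suc j)
  let ?X = "[:0, 1:] :: complex poly poly"
  have "pderiv (taylor_s (Suc j) (?X * f))
      = taylor_s (Suc j) f + ?X * pderiv (taylor_s (Suc j) f) - pderiv (taylor_s j f)"
    unfolding Suc.IH pderiv_diff pderiv_mult by (simp add: pderiv_pCons)
  also have "\<dots> = taylor_s (Suc j) f + of_nat (Suc j) *\<^sub>C taylor_s (Suc j) f
      - of_nat (Suc (Suc j)) *\<^sub>C (?X * taylor_s (Suc (Suc j)) f)"
    unfolding pderiv_taylor_s scaleC_mult_right complex_vector.scale_minus_left
    by (simp add: scaleC_mult_right del: taylor_s.simps mult_pCons_left of_nat_Suc)
  also have "\<dots> = (- of_nat (Suc (Suc j))) *\<^sub>C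
      (?X * taylor_s (Suc (Suc j)) f - taylor_s (Suc j) f)"
    by (simp only: complex_vector.scale_minus_left complex_vector.scale_right_diff_distrib
        of_nat_Suc[of "Suc j"] scaleC_add_left scaleC_one)
      (simp add: algebra_simps del: taylor_s.simps mult_pCons_left of_nat_Suc)
  \<comment> \<open>The differentiated identity is the wanted one multiplied by
    \<open>- of_nat (Suc (Suc j))\<close>, which is nonzero.\<close>
  finally have "(- of_nat (Suc (Suc j)) :: complex) = 0 \<or> taylor_s (Suc (Suc j)) (?X * f) =
      ?X * taylor_s (Suc (Suc j)) f - taylor_s (Suc j) f"
    unfolding pderiv_taylor_s complex_vector.scale_cancel_left by blast
  moreover have "(- of_nat (Suc (Suc j)) :: complex) \<noteq> 0"
    by (simp del: of_nat_Suc)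
  ultimately show ?case by blast
qed

lemma taylor_s_const: "taylor_s (Suc j) [:a:] = 0"
proof (induction j)
  case (Suc j)
  then show ?case by (simp only: taylor_s.simps(2)[of "Suc j"]) simp
qed (simp add: pderiv_pCons)

lemma coeff_taylor_s_eq_0: "coeff f (k + j) = 0 \<Longrightarrow> coeff (taylor_s j f) k = 0"
proof (induction j arbitrary: k)
  case (Suc j)
  then have "coeff (taylor_s j f) (Suc k) = 0" by simp
  then show ?case by (simp add: coeff_pderiv)
qed simp

lemma taylor_s_eq_0: "degree f < j \<Longrightarrow> taylor_s j f = 0"
  by (rule poly_eqI) (simp add: coeff_taylor_s_eq_0 coeff_eq_0)

text \<open>Taylor's formula, by induction along f = a + s g with \<open>taylor_s_Suc_times\<close>.
  Any \<open>N\<close> beyond the degree in s is allowed, so that several polynomials can share one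
  bound.\<close>

lemma shift_s_eq_taylor_s:
  "degree f < N \<Longrightarrow> shift_s n f = (\<Sum>j<N. of_int n ^ j *\<^sub>C taylor_s j f)"
proof (induction f arbitrary: N)
  case 0
  then show ?case using clinear_0[OF clinear_taylor_s] by simp
next
  case (pCons a f)
  let ?X = "[:0, 1:] :: complex poly poly"
  have e: "pCons a f = [:a:] + ?X * f" by simp
  from pCons.prems obtain N' where N: "N = Suc N'" by (cases N) auto
  have c: "of_int n ^ Suc j *\<^sub>C taylor_s (Suc j) (pCons a f)
      = ?X * (of_int n ^ Suc j *\<^sub>C taylor_s (Suc j) f) - of_int n *\<^sub>C of_int n ^ j *\<^sub>C taylor_s j f" for j
    unfolding e clinear_add[OF clinear_taylor_s] taylor_s_const taylor_s_Suc_times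
    by (simp add: complex_vector.scale_right_diff_distrib scaleC_mult_right scaleC_scaleC
        del: taylor_s.simps mult_pCons_left)
  have sh: "shift_s n (pCons a f) = [:a:] + ?X * shift_s n f - of_int n *\<^sub>C shift_s n f"
  proof -
    have "[:[:of_int n:]:] * shift_s n f = of_int n *\<^sub>C shift_s n f"
      by (simp add: scaleC_poly_poly_eq_smult)
    then show ?thesis
      by (simp only: e shift_s_simps left_diff_distrib add_diff_eq)
  qed
  show ?case
  \<comment> \<open>For \<open>f = 0\<close> the number \<open>N'\<close> may be 0, and then the
    induction hypothesis does not apply to it.\<close>
  proof (cases "f = 0")
    case True
    then show ?thesis
      using sh by (simp add: N sum.lessThan_Suc_shift taylor_s_const scaleC_one del: taylor_s.simps(2) sum.lessThan_Suc)
  next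
    case False
    then have d: "degree f < N'" using pCons.prems by (simp add: N)
    have "(\<Sum>j<N. of_int n ^ j *\<^sub>C taylor_s j (pCons a f))
      = pCons a f + (?X * (\<Sum>j<N'. of_int n ^ Suc j *\<^sub>C taylor_s (Suc j) f)
         - of_int n *\<^sub>C (\<Sum>j<N'. of_int n ^ j *\<^sub>C taylor_s j f))"
      unfolding N sum.lessThan_Suc_shift c
      by (simp add: sum_subtractf sum_distrib_left complex_vector.scale_sum_right scaleC_one
        del: taylor_s.simps(2) mult_pCons_left power_Suc)
    also have "(\<Sum>j<N'. of_int n ^ Suc j *\<^sub>C taylor_s (Suc j) f) = shift_s n f - f"
      using pCons.IH[of "Suc N'"] d
      by (simp add: sum.lessThan_Suc_shift scaleC_one del: taylor_s.simps(2) power_Suc sum.lessThan_Suc)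
    also have "(\<Sum>j<N'. of_int n ^ j *\<^sub>C taylor_s j f) = shift_s n f"
      using pCons.IH[OF d] ..
    finally have "(\<Sum>j<N. of_int n ^ j *\<^sub>C taylor_s j (pCons a f)) =
      [:a:] + ?X * f + (?X * (shift_s n f - f) - of_int n *\<^sub>C shift_s n f)"
      unfolding e[symmetric] .
    then show ?thesis
      by (simp only: sh right_diff_distrib) (simp only: algebra_simps)
  qed
qed

section \<open>Primitives in one variable\<close>

text \<open>The primitive without constant term. Coefficients in an arbitrary complex vector space
  let it serve in t, on \<open>complex poly\<close>, and in s, on
  \<open>complex poly poly\<close>.\<close>

definition antideriv :: "'a::complex_vector poly \<Rightarrow> 'a poly"
  where "antideriv f = pCons 0 (\<Sum>k\<le>degree f. monom ((1 / of_nat (Suc k)) *\<^sub>C coeff f k) k)"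

lemma coeff_antideriv:
  "coeff (antideriv f) n = (case n of 0 \<Rightarrow> 0 | Suc k \<Rightarrow> (1 / of_nat (Suc k)) *\<^sub>C coeff f k)"
  by (cases n) (auto simp: antideriv_def coeff_sum coeff_eq_0 not_le simp del: of_nat_Suc)

lemma clinear_antideriv: "clinear antideriv"
  by (rule clinearI)
    (auto simp: poly_eq_iff coeff_antideriv scaleC_add_right scaleC_scaleC mult.commute split: nat.split)

lemma antideriv_pderiv:
  "antideriv (pderiv p) = p - [:coeff p 0:]" for p :: "complex poly"
  by (auto simp: poly_eq_iff coeff_antideriv coeff_pderiv scaleC_complex_def coeff_pCons
      simp del: of_nat_Suc split: nat.split)

lemma antideriv_pderiv_s: "antideriv (pderiv f) = f - [:coeff f 0:]" for f :: "complex poly poly"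
  by (auto simp: poly_eq_iff[of "_ :: complex poly poly"] coeff_antideriv coeff_pderiv
      scaleC_poly_eq_smult coeff_pCons of_nat_poly simp del: of_nat_Suc split: nat.split)

lemma coeff_map_antideriv: "coeff (map_poly antideriv f) n = antideriv (coeff f n)"
  by (simp add: coeff_map_poly clinear_0[OF clinear_antideriv])

lemma clinear_map_antideriv: "clinear (map_poly antideriv)"
  by (rule clinearI)
    (simp_all add: poly_eq_iff[of "_ :: _ poly poly"] coeff_map_antideriv clinear_add[OF clinear_antideriv]
      clinear_scale[OF clinear_antideriv])

lemma antideriv_deriv_t:
  "map_poly antideriv (deriv_t f) = f - map_poly (\<lambda>p. [:coeff p 0:]) f"
  by (simp add: poly_eq_iff[of "_ :: complex poly poly"] coeff_map_antideriv antideriv_pderiv coeff_map_poly)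

section \<open>Local nilpotency and commutation of the two derivatives\<close>

lemma coeff_funpow_pderiv_eq_0:
  fixes f :: "'a::idom poly"
  shows "coeff f (k + j) = 0 \<Longrightarrow> coeff ((pderiv ^^ j) f) k = 0"
proof (induction j arbitrary: k)
  case (Suc j)
  then have "coeff ((pderiv ^^ j) f) (Suc k) = 0" by simp
  then show ?case by (simp add: coeff_pderiv)
qed simp

lemma funpow_pderiv_eq_0: "degree f < j \<Longrightarrow> (pderiv ^^ j) f = 0" for f :: "'a::idom poly"
  by (rule poly_eqI) (simp add: coeff_funpow_pderiv_eq_0 coeff_eq_0)

lemma funpow_deriv_t_nilpotent: "\<exists>N. \<forall>j\<ge>N. (deriv_t ^^ j) f = 0"
proof (intro exI allI impI)
  \<comment> \<open>The sum of the degrees in t bounds each of them, uniformly in the power of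
    s.\<close>
  fix j assume j: "j \<ge> Suc (\<Sum>k\<le>degree f. degree (coeff f k))"
  have c: "coeff ((deriv_t ^^ j) f) k = (pderiv ^^ j) (coeff f k)" for j k
    by (induction j) simp_all
  have "(pderiv ^^ j) (coeff f k) = 0" for k
  proof (cases "k \<le> degree f")
    case True
    then have "degree (coeff f k) \<le> (\<Sum>k\<le>degree f. degree (coeff f k))"
      by (intro member_le_sum) auto
    with j show ?thesis by (intro funpow_pderiv_eq_0) simp
  next
    case False
    then have "coeff f k = 0" by (simp add: coeff_eq_0)
    with j show ?thesis by (intro funpow_pderiv_eq_0) simp
  qed
  then show "(deriv_t ^^ j) f = 0" by (simp add: poly_eq_iff[of "_ :: complex poly poly"] c)
qed

lemma pderiv_deriv_t: "pderiv (deriv_t f) = deriv_t (pderiv f)"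
  by (simp add: poly_eq_iff[of "_ :: complex poly poly"] coeff_pderiv of_nat_poly pderiv_smult
      del: of_nat_Suc)

section \<open>Common kernel of the derivatives\<close>

lemma slot_funpow:
  assumes "clinear A"
  shows "(slot i A ^^ n) u = slot i (A ^^ n) u"
proof (induction n)
  case 0
  have "A ^^ 0 = (\<lambda>x. x)" by auto
  then show ?case by (simp add: slot_id del: funpow.simps)
next
  case (Suc n)
  have "A ^^ Suc n = (\<lambda>x. A ((A ^^ n) x))" by auto
  then show ?case
    using slot_compose[OF assms clinear_funpow[OF assms], of i n u] Suc by (simp del: funpow.simps add: funpow.simps(2)[of n "slot i A"])
qed

text \<open>For a sum of tensors the larger of two bounds is taken; hence vanishing for all
  \<open>j \<ge> N\<close> and not for one index only.\<close>

lemma slot_nilpotent: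
  assumes "\<And>j. clinear (A j)" and "\<And>x. \<exists>N. \<forall>j\<ge>N. A j x = 0"
  shows "\<exists>N. \<forall>j\<ge>N::nat. slot i (A j) u = 0"
proof (induction u rule: pure_induct)
  case (pure f v)
  obtain N where "\<forall>j\<ge>N. A j (f i) = 0" using assms(2) by blast
  then have "\<forall>j\<ge>N. slot i (A j) (pure f v) = 0"
    by (simp add: slot_pure assms(1) clinear_0[OF clinear_pure_upd])
  then show ?case ..
next
  case (add u w)
  then obtain M N where "\<forall>j\<ge>M. slot i (A j) u = 0" "\<forall>j\<ge>N. slot i (A j) w = 0" by blast
  then show ?case
    by (intro exI[of _ "max M N"]) (simp add: clinear_add[OF clinear_slot[OF assms(1)]])
qed

lemma slot_nilpotent_pderiv: "\<exists>N. (slot i pderiv ^^ N) u = 0"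
  and slot_nilpotent_deriv_t: "\<exists>N. (slot i deriv_t ^^ N) u = 0"
proof -
  have "\<exists>N. \<forall>j\<ge>N. (pderiv ^^ j) f = 0" for f :: "complex poly poly"
    using funpow_pderiv_eq_0[of f] by (metis Suc_le_lessD)
  from slot_nilpotent[OF clinear_funpow[OF clinear_pderiv] this, of i u]
  show "\<exists>N. (slot i pderiv ^^ N) u = 0"
    by (auto simp: slot_funpow clinear_pderiv)
next
  from slot_nilpotent[OF clinear_funpow[OF clinear_deriv_t] funpow_deriv_t_nilpotent, of i u]
  show "\<exists>N. (slot i deriv_t ^^ N) u = 0"
    by (auto simp: slot_funpow clinear_deriv_t)
qed

text \<open>Operators are treated one by one. Applied repeatedly to a vector killed by the earlier
  ones, the new operator has a last nonzero iterate, and commutation keeps this iterate in the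
  earlier kernels.\<close>

lemma exists_common_kernel:
  fixes d :: "'k \<Rightarrow> 'w \<Rightarrow> 'w::complex_vector"
  assumes lin: "\<And>k. k \<in> K \<Longrightarrow> clinear (d k)"
    and comm: "\<And>k l x. k \<in> K \<Longrightarrow> l \<in> K \<Longrightarrow> d k (d l x) = d l (d k x)"
    and nil: "\<And>k x. k \<in> K \<Longrightarrow> \<exists>N. (d k ^^ N) x = 0"
    and closed: "\<And>k x. k \<in> K \<Longrightarrow> x \<in> U \<Longrightarrow> d k x \<in> U"
    and "finite K" "x \<in> U" "x \<noteq> 0"
  shows "\<exists>y\<in>U. y \<noteq> 0 \<and> (\<forall>k\<in>K. d k y = 0)"
  using \<open>finite K\<close> lin comm nil closed
proof (induction K rule: finite_induct)
  case empty
  then show ?case using assms(6,7) by auto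
next
  case (insert k K)
  have "\<exists>y\<in>U. y \<noteq> 0 \<and> (\<forall>k\<in>K. d k y = 0)"
    by (rule insert.IH) (simp_all add: insert.prems)
  then obtain y where y: "y \<in> U" "y \<noteq> 0" "\<And>l. l \<in> K \<Longrightarrow> d l y = 0" by blast
  define N where "N = (LEAST N. (d k ^^ N) y = 0)"
  have N: "(d k ^^ N) y = 0"
    unfolding N_def by (rule LeastI_ex) (simp add: insert.prems(3))
  then obtain M where M: "N = Suc M" using y(2) by (cases N) auto
  have nz: "(d k ^^ M) y \<noteq> 0"
    using not_less_Least[of M "\<lambda>N. (d k ^^ N) y = 0"] M by (simp add: N_def)
  have mem: "(d k ^^ j) y \<in> U" for j
    by (induction j) (simp_all add: y(1) insert.prems(4))
  have "d l ((d k ^^ j) y) = 0" if "l \<in> K" for l j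
  proof (induction j)
    case (Suc j)
    have "d l (d k ((d k ^^ j) y)) = d k (d l ((d k ^^ j) y))"
      using that by (intro insert.prems(2)) auto
    then show ?case using Suc clinear_0[OF insert.prems(1)] by simp
  qed (simp add: y(3) that)
  then show ?case using nz mem N M by (intro bexI[of _ "(d k ^^ M) y"]) auto
qed

text \<open>The projection of C[s,t] onto the constants, written as an endomorphism so that it can
  act in a slot.\<close>

definition const_proj :: "complex poly poly \<Rightarrow> complex poly poly"
  where "const_proj f = coeff (coeff f 0) 0 *\<^sub>C 1"

lemma clinear_const_proj: "clinear const_proj"
  by (rule clinearI) (simp_all add: const_proj_def scaleC_add_left scaleC_scaleC scaleC_complex_def)

lemma const_proj_eq: "const_proj f = map_poly (\<lambda>p. [:coeff p 0:]) [:coeff f 0:]"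
  by (simp add: const_proj_def scaleC_poly_poly_eq_smult one_pCons map_poly_pCons)

text \<open>In one variable, the identity minus primitive after derivative is the projection to the
  constant term. It fixes \<open>u\<close> when the derivative kills \<open>u\<close>, and
  \<open>const_proj\<close> is the composite of the projections for s and t.\<close>

lemma slot_const_proj:
  assumes "slot i pderiv u = 0" "slot i deriv_t u = 0"
  shows "slot i const_proj u = u"
proof -
  let ?Q = antideriv and ?R = "map_poly antideriv"
  have "slot i (\<lambda>f. f - ?Q (pderiv f)) u = u"
    by (simp add: slot_minus clinear_id slot_id slot_compose clinear_compose clinear_antideriv
        clinear_pderiv assms clinear_0[OF clinear_slot])
  moreover have "slot i (\<lambda>f. f - ?R (deriv_t f)) u = u"
    by (simp add: slot_minus clinear_id slot_id slot_compose clinear_compose clinear_map_antideriv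
        clinear_deriv_t assms clinear_0[OF clinear_slot])
  moreover have "const_proj = (\<lambda>f. (\<lambda>f. f - ?R (deriv_t f)) ((\<lambda>f. f - ?Q (pderiv f)) f))"
    by (simp add: fun_eq_iff const_proj_eq antideriv_pderiv_s antideriv_deriv_t del: deriv_t_simps)
  ultimately show ?thesis
    using slot_compose[of "\<lambda>f. f - ?R (deriv_t f)" "\<lambda>f. f - ?Q (pderiv f)" i u]
    by (simp add: clinear_minus clinear_id clinear_compose clinear_antideriv clinear_map_antideriv
        clinear_pderiv clinear_deriv_t)
qed

text \<open>Each \<open>slot i const_proj\<close> fixes \<open>u\<close> but sends every pure tensor
  to a multiple of one with 1 in slot \<open>i\<close>. Slot by slot, only tensors
  \<open>pure (\<lambda>_. 1) v\<close> remain, and these form a subspace.\<close>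

lemma ex_pure_one:
  fixes u :: "('i::finite, complex poly poly, 'v::complex_vector) tensor"
  assumes "\<And>i. slot i pderiv u = 0" "\<And>i. slot i deriv_t u = 0"
  shows "\<exists>v. u = pure (\<lambda>_. 1) v"
proof -
  have proj: "slot i const_proj u = u" for i
    using assms by (intro slot_const_proj)
  let ?S = "\<lambda>I :: 'i set. {pure f v | f (v :: 'v). \<forall>i\<in>I. f i = (1 :: complex poly poly)}"
  have "u \<in> complex_vector.span (?S I)" if "finite I" for I
    using that
  proof (induction I rule: finite_induct)
    case empty
    show ?case
      by (induction u rule: pure_induct) (auto intro: complex_vector.span_base complex_vector.span_add)
  next
    case (insert i I)
    have "slot i const_proj w \<in> complex_vector.span (?S (insert i I))"
      if "w \<in> complex_vector.span (?S I)" for w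
      using that
    proof (induction w rule: complex_vector.span_induct_alt)
      case base
      then show ?case by (simp add: clinear_0[OF clinear_slot] clinear_const_proj complex_vector.span_zero)
    next
      case (step c x y)
      then obtain f v where x: "x = pure f v" "\<forall>i\<in>I. f i = 1" by blast
      have "slot i const_proj x = coeff (coeff (f i) 0) 0 *\<^sub>C pure (f(i := 1)) v"
        by (simp add: x slot_pure clinear_const_proj const_proj_def clinear_scale[OF clinear_pure_upd])
      also have "\<dots> \<in> complex_vector.span (?S (insert i I))"
        using x(2) insert.hyps by (intro complex_vector.span_scale complex_vector.span_base) auto
      finally show ?case using step
        by (simp add: clinear_add[OF clinear_slot] clinear_scale[OF clinear_slot] clinear_const_proj
            complex_vector.span_add complex_vector.span_scale)
    qed
    from this[OF insert.IH] show ?case by (simp add: proj)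
  qed
  from this[of UNIV] have "u \<in> complex_vector.span (?S UNIV)" by simp
  moreover have "complex_vector.subspace (range (pure (\<lambda>_. 1 :: complex poly poly) :: 'v \<Rightarrow> ('i, _, _) tensor))"
    by (rule module_hom.subspace_image[OF clinear_module_hom[OF clinear_pure]]) simp
  moreover have "?S UNIV \<subseteq> range (pure (\<lambda>_. 1))"
    by (auto simp: fun_eq_iff[symmetric])
  ultimately show ?thesis using complex_vector.span_minimal by blast
qed

section \<open>Dependence of the action on the mode n\<close>

text \<open>A tensor involves finitely many vectors of the last factor, and the bounds of two
  summands are dominated by \<open>k + l\<close>.\<close>

lemma last_slot_restricted:
  fixes act :: "bms \<Rightarrow> 'v::complex_vector \<Rightarrow> 'v"
  assumes "\<And>x. clinear (act x)" "restricted_module act"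
  shows "\<exists>k::nat. \<forall>n::int. n \<ge> int k \<longrightarrow> (\<forall>x\<in>bms_homogeneous n. last_slot (act x) u = 0)"
proof (induction u rule: pure_induct)
  case (pure f v)
  obtain k :: nat where "\<forall>n. n \<ge> int k \<longrightarrow> (\<forall>x\<in>bms_homogeneous n. act x v = 0)"
    using assms(2) unfolding restricted_module_def by blast
  then show ?case
    by (intro exI[of _ k]) (simp add: last_slot_pure assms(1) clinear_0[OF clinear_pure])
next
  case (add u w)
  then obtain k l :: nat
    where k: "\<forall>n. n \<ge> int k \<longrightarrow> (\<forall>x\<in>bms_homogeneous n. last_slot (act x) u = 0)"
      and l: "\<forall>n. n \<ge> int l \<longrightarrow> (\<forall>x\<in>bms_homogeneous n. last_slot (act x) w = 0)" by blast
  have "last_slot (act x) u = 0 \<and> last_slot (act x) w = 0"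
    if "n \<ge> int (k + l)" "x \<in> bms_homogeneous n" for n x
    using that k[rule_format, of n x] l[rule_format, of n x] by simp
  then show ?case
    by (intro exI[of _ "k + l"] allI impI ballI) (simp only: clinear_add[OF clinear_last_slot] assms(1) add_0)
qed

text \<open>The truncation is valid for the whole tensor and stays valid when enlarged, so one can
  be chosen for all slots. The vanishing of the further Taylor terms is what
  \<open>exp_poly_coeff_mem\<close> asks of its coefficients.\<close>

lemma slot_shift_s_eq_taylor_s:
  "\<exists>N. \<forall>M\<ge>N. slot i (taylor_s M) u = 0 \<and>
    (\<forall>n. slot i (shift_s n) u = (\<Sum>j<M. of_int n ^ j *\<^sub>C slot i (taylor_s j) u))"
proof (induction u rule: pure_induct)
  case (pure f v)
  show ?case
  proof (intro exI[of _ "Suc (degree (f i))"] allI impI conjI)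
    fix M n assume "M \<ge> Suc (degree (f i))"
    then have M: "degree (f i) < M" by simp
    show "slot i (taylor_s M) (pure f v) = 0"
      by (simp add: slot_pure clinear_taylor_s taylor_s_eq_0[OF M] clinear_0[OF clinear_pure_upd])
    show "slot i (shift_s n) (pure f v) = (\<Sum>j<M. of_int n ^ j *\<^sub>C slot i (taylor_s j) (pure f v))"
      by (simp add: slot_pure clinear_taylor_s clinear_shift_s shift_s_eq_taylor_s[OF M]
          clinear_sum[OF clinear_pure_upd] clinear_scale[OF clinear_pure_upd])
  qed
next
  case (add u w)
  then obtain M N where
    M: "\<forall>L\<ge>M. slot i (taylor_s L) u = 0 \<and> (\<forall>n. slot i (shift_s n) u = (\<Sum>j<L. of_int n ^ j *\<^sub>C slot i (taylor_s j) u))"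
    and N: "\<forall>L\<ge>N. slot i (taylor_s L) w = 0 \<and> (\<forall>n. slot i (shift_s n) w = (\<Sum>j<L. of_int n ^ j *\<^sub>C slot i (taylor_s j) w))"
    by blast
  show ?case
  proof (intro exI[of _ "max M N"] allI impI)
    fix L assume "L \<ge> max M N"
    then show "slot i (taylor_s L) (u + w) = 0 \<and> (\<forall>n. slot i (shift_s n) (u + w)
        = (\<Sum>j<L. of_int n ^ j *\<^sub>C slot i (taylor_s j) (u + w)))"
      using M[rule_format, of L] N[rule_format, of L]
      by (simp add: clinear_add[OF clinear_slot] clinear_taylor_s clinear_shift_s scaleC_add_right sum.distrib)
  qed
qed

section \<open>Operators preserving a subspace\<close>

text \<open>Linearity is part of the notion because \<open>slot i A\<close> is meaningful only for
  linear \<open>A\<close>.\<close>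

definition slot_stable ::
  "('i::finite, 'a::complex_vector, 'v::complex_vector) tensor set \<Rightarrow> 'i \<Rightarrow> ('a \<Rightarrow> 'a) \<Rightarrow> bool"
  where "slot_stable U i A \<longleftrightarrow> clinear A \<and> (\<forall>u\<in>U. slot i A u \<in> U)"

lemma slot_stable_cong: "slot_stable U i A \<Longrightarrow> (\<And>x. A x = B x) \<Longrightarrow> slot_stable U i B"
  by (metis ext)

lemma slot_stable_compose: "slot_stable U i A \<Longrightarrow> slot_stable U i B \<Longrightarrow> slot_stable U i (\<lambda>x. A (B x))"
  by (simp add: slot_stable_def clinear_compose slot_compose)

lemma
  assumes "complex_vector.subspace U"
  shows slot_stable_plus: "slot_stable U i A \<Longrightarrow> slot_stable U i B \<Longrightarrow> slot_stable U i (\<lambda>x. A x + B x)"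
    and slot_stable_minus: "slot_stable U i A \<Longrightarrow> slot_stable U i B \<Longrightarrow> slot_stable U i (\<lambda>x. A x - B x)"
    and slot_stable_scaleC: "slot_stable U i A \<Longrightarrow> slot_stable U i (\<lambda>x. c *\<^sub>C A x)"
    and slot_stable_id: "slot_stable U i (\<lambda>x. x)"
    and slot_stable_zero: "slot_stable U i (\<lambda>x. 0)"
  using assms
  by (simp_all add: slot_stable_def clinear_plus clinear_minus clinear_scaleC clinear_id clinear_zero
      slot_plus slot_minus slot_scaleC slot_id slot_zero complex_vector.subspace_add
      complex_vector.subspace_diff complex_vector.subspace_scale complex_vector.subspace_0)

text \<open>Stable operators form an algebra, and multiplication by \<open>q\<close> is a polynomial
  in the multiplications by t and s. The two inductions follow the nesting of
  \<open>complex poly poly\<close>.\<close>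

lemma slot_stable_times:
  fixes U :: "('i::finite, complex poly poly, 'v::complex_vector) tensor set"
  assumes U: "complex_vector.subspace U"
    and t: "slot_stable U i ((*) [:[:0, 1:]:])"
    and s: "slot_stable U i ((*) [:0, 1:])"
  shows "slot_stable U i ((*) q)"
proof -
  have t': "slot_stable U i ((*) [:p:])" for p
  proof (induction p)
    case 0
    have "(*) [:0 :: complex poly:] = (\<lambda>x. 0)" by (simp add: fun_eq_iff)
    then show ?case by (rule ssubst) (rule slot_stable_zero[OF U])
  next
    case (pCons a p)
    have "(*) [:pCons a p:] = (\<lambda>x. a *\<^sub>C x + [:[:0, 1:]:] * ([:p:] * x))"
    proof
      fix x
      have "[:pCons a p:] = [:[:a:]:] + [:[:0, 1:]:] * [:p:]" by simp
      then have "[:pCons a p:] * x = [:[:a:]:] * x + [:[:0, 1:]:] * ([:p:] * x)"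
        by (simp only: distrib_right mult.assoc)
      then show "[:pCons a p:] * x = a *\<^sub>C x + [:[:0, 1:]:] * ([:p:] * x)"
        by (simp add: scaleC_poly_poly_eq_smult)
    qed
    then show ?case
      using slot_stable_plus[OF U slot_stable_scaleC[OF U slot_stable_id[OF U]] slot_stable_compose[OF t pCons.IH]]
      by (simp only:)
  qed
  show ?thesis
  proof (induction q)
    case 0
    have "(*) (0 :: complex poly poly) = (\<lambda>x. 0)" by (simp add: fun_eq_iff)
    then show ?case by (rule ssubst) (rule slot_stable_zero[OF U])
  next
    case (pCons a q)
    have "(*) (pCons a q) = (\<lambda>x. [:a:] * x + [:0, 1:] * (q * x))"
    proof
      fix x
      have "pCons a q = [:a:] + [:0, 1:] * q" by simp
      then show "pCons a q * x = [:a:] * x + [:0, 1:] * (q * x)"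
        by (simp only: distrib_right mult.assoc)
    qed
    then show ?case
      using slot_stable_plus[OF U t' slot_stable_compose[OF s pCons.IH]] by (simp only:)
  qed
qed

lemma taylor_s_numerals:
  "taylor_s 1 f = - pderiv f"
  "taylor_s 2 f = (1 / 2) *\<^sub>C pderiv (pderiv f)"
  "taylor_s 3 f = - ((1 / 6) *\<^sub>C pderiv (pderiv (pderiv f)))"
  by (simp_all add: numeral_eq_Suc scaleC_one scaleC_scaleC clinear_neg[OF clinear_pderiv]
      clinear_scale[OF clinear_pderiv])

text \<open>\<open>w m\<close> is the coefficient of \<open>n ^ m\<close> in \<open>\<lambda>\<^bsup>-n\<^esup> W\<^sub>n\<close>.\<close>

lemma pderiv_from_W_coeffs:
  fixes a :: complex
  defines "w \<equiv> \<lambda>m f. [:[:0, 1:]:] * taylor_s m f - a *\<^sub>C taylor_s (m - 1) f"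
  shows "a\<^sup>2 *\<^sub>C pderiv f = 3 *\<^sub>C ([:[:0, 1:]:] * w 3 f) - w 1 (w 2 f)"
proof -
  let ?t = "[:[:0, 1:]:] :: complex poly poly"
  define D where "D = (pderiv :: complex poly poly \<Rightarrow> _)"
  have t: "D (?t * g) = ?t * D g" for g
    unfolding D_def pderiv_mult by (simp add: pderiv_pCons)
  have l: "D (x + y) = D x + D y" "D (x - y) = D x - D y" "D (- x) = - D x" "D (c *\<^sub>C x) = c *\<^sub>C D x" for x y c
    by (simp_all add: D_def clinear_scale[OF clinear_pderiv] pderiv_add pderiv_diff pderiv_minus)
  have w1: "w 1 g = - (?t * D g) - a *\<^sub>C g" for g
    by (simp add: w_def D_def pderiv_minus scaleC_one)
  have w2: "w 2 g = (1 / 2) *\<^sub>C (?t * D (D g)) + a *\<^sub>C D g" for g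
    using taylor_s_numerals(1,2)[of g] by (simp add: w_def D_def scaleC_mult_right del: mult_pCons_left)
  have w3: "w 3 g = - ((1 / 6) *\<^sub>C (?t * D (D (D g)))) - (a / 2) *\<^sub>C D (D g)" for g
    using taylor_s_numerals(2,3)[of g]
    by (simp add: w_def D_def scaleC_mult_right scaleC_scaleC del: mult_pCons_left)
  have "w 1 (w 2 f) = - ((1 / 2) *\<^sub>C (?t * (?t * D (D (D f))))) - a *\<^sub>C (?t * D (D f)) - (a / 2) *\<^sub>C (?t * D (D f)) - a\<^sup>2 *\<^sub>C D f"
    unfolding w1 w2 l t
    by (simp add: algebra_simps scaleC_add_right scaleC_add_left scaleC_mult_right scaleC_mult_left scaleC_scaleC
        power2_eq_square del: mult_pCons_left mult_pCons_right)
  moreover have "3 *\<^sub>C (?t * w 3 f) = - ((1 / 2) *\<^sub>C (?t * (?t * D (D (D f))))) - (3 * a / 2) *\<^sub>C (?t * D (D f))"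
    unfolding w3
    by (simp add: algebra_simps complex_vector.scale_right_diff_distrib scaleC_mult_right scaleC_scaleC
        del: mult_pCons_left mult_pCons_right)
  moreover have "(3 * a / 2) *\<^sub>C Z = a *\<^sub>C Z + (a / 2) *\<^sub>C Z" for Z :: "complex poly poly"
    by (simp flip: scaleC_add_left)
  \<comment> \<open>The factor 3 is chosen to cancel the third-order terms; those of second order
    cancel as well, and only the first derivative remains.\<close>
  ultimately show ?thesis by (simp only: D_def) simp
qed

section \<open>The tensor product module\<close>

lemma phi_act_single: "phi_act lam \<alpha> \<beta> \<gamma> h (Poly_Mapping.single b 1) f = phi_basis lam \<alpha> \<beta> \<gamma> h b f"
  by (simp add: phi_act_def scaleC_one)

lemma submoduleI_basis:
  fixes A :: "('b \<Rightarrow>\<^sub>0 complex) \<Rightarrow> 'w::complex_vector \<Rightarrow> 'w"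
  assumes "\<And>u. clinear (\<lambda>x. A x u)" "complex_vector.subspace U"
    and "\<And>b u. u \<in> U \<Longrightarrow> A (Poly_Mapping.single b 1) u \<in> U"
  shows "submodule A U"
proof -
  have "A x u \<in> U" if "u \<in> U" for x u
  proof -
    have "A x u = (\<Sum>b\<in>Poly_Mapping.keys x. Poly_Mapping.lookup x b *\<^sub>C A (Poly_Mapping.single b 1) u)"
      by (subst free_eq_sum[of x]) (simp only: clinear_sum[OF assms(1)] clinear_scale[OF assms(1)])
    also have "\<dots> \<in> U"
      using assms(2,3) that by (intro complex_vector.subspace_sum complex_vector.subspace_scale) auto
    finally show ?thesis .
  qed
  then show ?thesis using assms(2) by (auto simp: submodule_def)
qed

lemma slot_last_slot_commute:
  assumes "clinear A" "clinear B"
  shows "slot i A (last_slot B u) = last_slot B (slot i A u)"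
  by (induction u rule: pure_induct)
    (simp_all add: assms slot_pure last_slot_pure clinear_add[OF clinear_slot] clinear_add[OF clinear_last_slot])

lemma shift_s_one [simp]: "shift_s k 1 = 1"
  using shift_s_simps(4)[of k 1] by (simp add: one_pCons)

text \<open>The shift fails to commute only with the multiplication by s in \<open>Lb n\<close>. The
  correction depends on \<open>k\<close>, \<open>lam\<close> and \<open>b\<close> alone; this order
  of quantifiers makes it the same in two slots with equal \<open>lam\<close>.\<close>

lemma shift_s_phi_basis_ex:
  "\<exists>c n. \<forall>\<alpha> \<beta> \<gamma> h f. shift_s k (phi_basis lam \<alpha> \<beta> \<gamma> h b f)
    = phi_basis lam \<alpha> \<beta> \<gamma> h b (shift_s k f) - c *\<^sub>C shift_s n f"
proof -
  note simps = shift_s_simps clinear_scale[OF clinear_shift_s] deriv_t_shift_s shift_s_shift_s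
  have *: "\<exists>c n. \<forall>\<alpha> \<beta> \<gamma> h f. shift_s k (phi_basis lam \<alpha> \<beta> \<gamma> h b f)
      = phi_basis lam \<alpha> \<beta> \<gamma> h b (shift_s k f) - c *\<^sub>C shift_s n f"
    if "\<And>\<alpha> \<beta> \<gamma> h f. shift_s k (phi_basis lam \<alpha> \<beta> \<gamma> h b f) = phi_basis lam \<alpha> \<beta> \<gamma> h b (shift_s k f)"
    by (intro exI[of _ 0]) (simp add: that)
  show ?thesis
  proof (cases b)
    case (Lb n)
    have "[:[:of_int k:]:] * p = of_int k *\<^sub>C p" for p :: "complex poly poly"
      by (simp add: scaleC_poly_poly_eq_smult)
    then have "shift_s k (phi_basis lam \<alpha> \<beta> \<gamma> h b f)
      = phi_basis lam \<alpha> \<beta> \<gamma> h b (shift_s k f) - (lam powi n * of_int k) *\<^sub>C shift_s (k + n) f"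
      for \<alpha> \<beta> \<gamma> h f
      unfolding Lb phi_basis.simps
      by (simp only: simps distrib_right left_diff_distrib complex_vector.scale_right_diff_distrib
          scaleC_add_right scaleC_scaleC add.commute[of n k]) (simp only: algebra_simps)
    then show ?thesis by blast
  qed (rule *; simp only: simps phi_basis.simps add.commute[of k])+
qed

text \<open>Sorting by powers of n lets the coefficient operators of \<open>Lb n\<close> be read
  off.\<close>

lemma phi_h_eq:
  "phi_h a g n = smult (of_int n) (g + smult a (phi_H a g)) - smult (of_int n ^ 2 * a) (phi_H a g)"
  by (rule poly_eqI) (simp add: phi_h_def algebra_simps power2_eq_square)

context
  fixes lam \<alpha> \<beta> \<gamma> :: "'m::finite \<Rightarrow> complex"
    and h :: "'m \<Rightarrow> complex poly"
    and act :: "bms \<Rightarrow> 'v::complex_vector \<Rightarrow> 'v"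
  assumes lam0: "\<And>i. lam i \<noteq> 0"
    and act: "lie_module bms_bracket act"
begin

abbreviation "\<Phi> i \<equiv> phi_act (lam i) (\<alpha> i) (\<beta> i) (\<gamma> i) (h i)"
abbreviation "\<phi> i \<equiv> phi_basis (lam i) (\<alpha> i) (\<beta> i) (\<gamma> i) (h i)"
abbreviation "T_act \<equiv> tensor_act \<Phi> act"

lemma clinear_act: "clinear (act x)"
  using act by (simp add: lie_module_def)

lemma clinear_T_act: "clinear (T_act x)" "clinear (\<lambda>x. T_act x u)"
  using lie_module_tensor_act[of bms_bracket \<Phi> act, OF lie_module_phi_act[OF lam0] act]
  by (simp_all add: lie_module_def)

lemma T_act_basis:
  "T_act (Poly_Mapping.single b 1) u = (\<Sum>i\<in>UNIV. slot i (\<phi> i b) u) + last_slot (act (Poly_Mapping.single b 1)) u"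
proof -
  have "\<Phi> i (Poly_Mapping.single b 1) = \<phi> i b" for i
    by (simp add: fun_eq_iff phi_act_single)
  then show ?thesis
    using tensor_act_eq_slots[of \<Phi> "Poly_Mapping.single b 1" act u, OF clinear_phi_act(1) clinear_act]
    by simp
qed

section \<open>Equal parameters: a proper nonzero submodule\<close>

lemma shift_s_T_act:
  assumes "\<And>f. shift_s k (\<phi> i b f) = \<phi> i b (shift_s k f) - c *\<^sub>C shift_s n f"
  shows "slot i (shift_s k) (T_act (Poly_Mapping.single b 1) u)
    = T_act (Poly_Mapping.single b 1) (slot i (shift_s k) u) - c *\<^sub>C slot i (shift_s n) u"
proof -
  have i: "slot i (shift_s k) (slot i (\<phi> i b) u)
      = slot i (\<phi> i b) (slot i (shift_s k) u) - c *\<^sub>C slot i (shift_s n) u"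
    by (simp add: assms slot_minus slot_scaleC clinear_phi_basis clinear_shift_s clinear_compose
        clinear_scaleC flip: slot_compose)
  have "slot i (shift_s k) (slot j (\<phi> j b) u) = slot j (\<phi> j b) (slot i (shift_s k) u)" if "j \<noteq> i" for j
    using that by (intro slot_commute) (auto simp: clinear_phi_basis clinear_shift_s)
  then have "slot i (shift_s k) (\<Sum>j\<in>UNIV. slot j (\<phi> j b) u)
      = (\<Sum>j\<in>UNIV. slot j (\<phi> j b) (slot i (shift_s k) u)) - c *\<^sub>C slot i (shift_s n) u"
    by (simp add: clinear_sum[OF clinear_slot] clinear_add[OF clinear_slot] clinear_shift_s i sum.remove[of UNIV i])
  then show ?thesis
    by (simp add: T_act_basis clinear_add[OF clinear_slot] clinear_shift_s slot_last_slot_commute clinear_act)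
qed

lemma not_irreducible_if_eq:
  assumes "lam i = lam j" "i \<noteq> j" and v: "v \<noteq> (0::'v)"
  shows "\<not> irreducible_module T_act"
proof -
  \<comment> \<open>Agreement of all shifts in slots \<open>i\<close> and \<open>j\<close> expresses
    dependence on the sum of the two variables. Letting \<open>k\<close> range over all integers
    gives closure, since the correction in \<open>shift_s_T_act\<close> is a shift by another
    integer.\<close>
  define U :: "('m, complex poly poly, 'v) tensor set"
    where "U = {u. \<forall>k. slot i (shift_s k) u = slot j (shift_s k) u}"
  have "submodule T_act U"
  proof (rule submoduleI_basis)
    show "complex_vector.subspace U"
      by (auto simp: U_def complex_vector.subspace_def clinear_shift_s clinear_0[OF clinear_slot]
          clinear_add[OF clinear_slot] clinear_scale[OF clinear_slot])
    fix b u assume "u \<in> U"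
    then have u: "slot i (shift_s k) u = slot j (shift_s k) u" for k by (auto simp: U_def)
    have "slot i (shift_s k) (T_act (Poly_Mapping.single b 1) u)
      = slot j (shift_s k) (T_act (Poly_Mapping.single b 1) u)" for k
    proof -
      obtain c n where "\<And>\<alpha> \<beta> \<gamma> h f. shift_s k (phi_basis (lam i) \<alpha> \<beta> \<gamma> h b f)
        = phi_basis (lam i) \<alpha> \<beta> \<gamma> h b (shift_s k f) - c *\<^sub>C shift_s n f"
        using shift_s_phi_basis_ex[of k "lam i" b] by blast
      then show ?thesis
        using shift_s_T_act[of k i b c n u] shift_s_T_act[of k j b c n u] assms(1) u by simp
    qed
    then show "T_act (Poly_Mapping.single b 1) u \<in> U" by (simp add: U_def)
  qed (rule clinear_T_act)
  moreover have "U \<noteq> {0}"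
  proof -
    have "pure (\<lambda>_. 1) v \<in> U"
      by (simp add: U_def slot_pure clinear_shift_s fun_upd_idem)
    moreover have "pure (\<lambda>_. 1) v \<noteq> (0 :: ('m, complex poly poly, 'v) tensor)"
      by (simp add: pure_eq_0_iff v)
    ultimately show ?thesis by blast
  qed
  moreover have "U \<noteq> UNIV"
  proof
    assume "U = UNIV"
    let ?X = "[:0, 1:] :: complex poly poly" and ?f = "\<lambda>_::'m. 1 :: complex poly poly"
    \<comment> \<open>This tensor is moved by the shift in slot \<open>i\<close> and fixed by the
      one in slot \<open>j\<close>.\<close>
    have "pure (?f(i := ?X)) v \<in> U" using \<open>U = UNIV\<close> by simp
    then have "slot i (shift_s 1) (pure (?f(i := ?X)) v) = slot j (shift_s 1) (pure (?f(i := ?X)) v)"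
      unfolding U_def by blast
    moreover have "shift_s 1 ?X = ?X - 1"
      using shift_s_simps(5)[of 1] by (simp add: one_pCons)
    ultimately have "pure (?f(i := ?X - 1)) v = pure (?f(i := ?X)) v"
      using assms(2) by (simp add: slot_pure clinear_shift_s fun_upd_idem)
    then have "pure (?f(i := 1)) v = 0"
      by (simp add: clinear_diff[OF clinear_pure_upd] del: fun_upd_apply)
    then show False by (auto simp: pure_eq_0_iff v split: if_splits)
  qed
  ultimately show ?thesis unfolding irreducible_module_def by blast
qed

section \<open>Distinct parameters: coefficient operators and the Weyl algebra\<close>

text \<open>\<open>A i k\<close> is the coefficient of \<open>n ^ k\<close> before the shift is
  expanded. After Taylor expansion, the coefficient of \<open>n ^ m\<close> collects the composites
  of \<open>A i k\<close> with \<open>taylor_s (m - k)\<close>. Distinct \<open>lam i\<close>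
  separate the slots.\<close>

lemma coeff_slot_stable:
  assumes "inj lam" "restricted_module act"
    and U: "submodule T_act U"
    and X: "\<And>n. Poly_Mapping.single (X n) 1 \<in> bms_homogeneous n"
    and A: "\<And>i k. clinear (A i k)"
    and \<phi>: "\<And>i n f. \<phi> i (X n) f = lam i powi n *\<^sub>C (\<Sum>k<K. of_int n ^ k *\<^sub>C A i k (shift_s n f))"
  shows "slot_stable U i (\<lambda>f. \<Sum>k<K. if m < k then 0 else A i k (taylor_s (m - k) f))"
proof -
  have lin: "clinear (\<lambda>f. A i k (taylor_s j f))" "clinear (\<lambda>f. A i k (shift_s n f))" for i k j n
    by (intro clinear_compose[OF A] clinear_taylor_s clinear_shift_s)+
  have lin': "clinear (\<lambda>f. if m < k then 0 else A i k (taylor_s (m - k) f))" for k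
    by (cases "m < k") (simp_all only: if_True if_False lin clinear_zero)
  have stab: "slot i (\<lambda>f. \<Sum>k<K. if m < k then 0 else A i k (taylor_s (m - k) f)) u \<in> U" if u: "u \<in> U" for u
  proof -
    \<comment> \<open>\<open>n0\<close> depends on \<open>u\<close>, which is harmless because
      \<open>exp_poly_coeff_mem\<close> uses only large n.\<close>
    obtain n0 :: nat where n0: "\<forall>n::int. n \<ge> int n0 \<longrightarrow> (\<forall>x\<in>bms_homogeneous n. last_slot (act x) u = 0)"
      using last_slot_restricted[OF clinear_act assms(2)] by blast
    have "\<forall>i. \<exists>N. \<forall>M\<ge>N. slot i (taylor_s M) u = 0 \<and>
        (\<forall>n. slot i (shift_s n) u = (\<Sum>j<M. of_int n ^ j *\<^sub>C slot i (taylor_s j) u))"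
      using slot_shift_s_eq_taylor_s by blast
    from choice[OF this] obtain N' where N': "\<And>i M. M \<ge> N' i \<Longrightarrow> slot i (taylor_s M) u = 0 \<and>
        (\<forall>n. slot i (shift_s n) u = (\<Sum>j<M. of_int n ^ j *\<^sub>C slot i (taylor_s j) u))"
      by blast
    \<comment> \<open>One truncation for all slots exists because the index type is finite.\<close>
    define N where "N = Max (range N')"
    have "N' i \<le> N" for i by (simp add: N_def)
    then have N: "j \<ge> N \<Longrightarrow> slot i (taylor_s j) u = 0"
      "slot i (shift_s n) u = (\<Sum>j<N. of_int n ^ j *\<^sub>C slot i (taylor_s j) u)" for i j n
      using N'[of i N] N'[of i j] order.trans[of "N' i" N j] by blast+
    define a where "a i k j = slot i (A i k) (slot i (taylor_s j) u)" for i k j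
    have mem: "(\<Sum>k<K. if m < k then 0 else a i k (m - k)) \<in> U"
    proof (rule exp_poly_coeff_mem[where I = UNIV and lam = lam and N = N and M = n0])
      show "complex_vector.subspace U" using U by (simp add: submodule_def)
      show "inj_on lam UNIV" "lam i \<noteq> 0" for i using assms(1) lam0 by simp_all
      show "a i k j = 0" if "j \<ge> N" for i k j
        using N(1)[OF that] by (simp add: a_def clinear_0[OF clinear_slot] A)
      fix n assume n: "n \<ge> n0"
      have slot_X: "slot i (\<phi> i (X (int n))) u = lam i ^ n *\<^sub>C (\<Sum>k<K. of_nat n ^ k *\<^sub>C (\<Sum>j<N. of_nat n ^ j *\<^sub>C a i k j))"
        for i
      proof -
        have "slot i (\<phi> i (X (int n))) u
          = lam i ^ n *\<^sub>C (\<Sum>k<K. of_nat n ^ k *\<^sub>C slot i (A i k) (slot i (shift_s (int n)) u))"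
        proof -
          have "\<phi> i (X (int n))
            = (\<lambda>f. lam i ^ n *\<^sub>C (\<Sum>k<K. of_nat n ^ k *\<^sub>C A i k (shift_s (int n) f)))"
            by (rule ext) (simp only: \<phi> power_int_of_nat of_int_of_nat_eq)
          then show ?thesis
            by (simp only: slot_scaleC slot_sum clinear_sum_fun clinear_scaleC lin finite_lessThan
                slot_compose[OF A clinear_shift_s])
        qed
        then show ?thesis
          by (simp add: N(2) a_def clinear_sum[OF clinear_slot] clinear_scale[OF clinear_slot] A)
      qed
      have "T_act (Poly_Mapping.single (X (int n)) 1) u \<in> U"
        using U u by (simp add: submodule_def)
      moreover have "last_slot (act (Poly_Mapping.single (X (int n)) 1)) u = 0"
        using n0[rule_format, of "int n"] X n by simp
      ultimately show "(\<Sum>i\<in>UNIV. lam i ^ n *\<^sub>C (\<Sum>k<K. of_nat n ^ k *\<^sub>C (\<Sum>j<N. of_nat n ^ j *\<^sub>C a i k j))) \<in> U"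
        by (simp add: T_act_basis slot_X)
    qed simp_all
    have "(\<Sum>k<K. if m < k then 0 else a i k (m - k))
      = slot i (\<lambda>f. \<Sum>k<K. if m < k then 0 else A i k (taylor_s (m - k) f)) u"
      unfolding slot_sum[OF finite_lessThan lin']
      by (intro sum.cong) (auto simp: a_def slot_zero slot_compose[OF A clinear_taylor_s])
    with mem show ?thesis by (simp only:)
  qed
  show ?thesis
    unfolding slot_stable_def by (intro conjI ballI stab clinear_sum_fun lin')
qed

text \<open>The constant coefficients of W and L give t and s. The derivative in s comes from J if
  \<open>\<alpha> i = 0\<close> and from W otherwise; in the same two cases the derivative in t
  comes from I and from L.\<close>

lemma weyl_slot_stable:
  assumes "inj lam" "restricted_module act" and U: "submodule T_act U"
    and ab: "\<alpha> i \<noteq> 0 \<or> \<beta> i \<noteq> 0"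
  shows "slot_stable U i ((*) p)" "slot_stable U i pderiv" "slot_stable U i deriv_t"
proof -
  let ?t = "[:[:0, 1:]:] :: complex poly poly" and ?s = "[:0, 1:] :: complex poly poly"
  define H where "H i = [:phi_H (\<alpha> i) (h i):]" for i
  have sub: "complex_vector.subspace U" using U by (simp add: submodule_def)
  note coeff = coeff_slot_stable[OF assms(1-3)]
  note st = slot_stable_plus[OF sub] slot_stable_minus[OF sub] slot_stable_scaleC[OF sub] slot_stable_compose
  have hom: "Poly_Mapping.single (Lb n) 1 \<in> bms_homogeneous n" "Poly_Mapping.single (Wb n) 1 \<in> bms_homogeneous n"
    "Poly_Mapping.single (Ib n) 1 \<in> bms_homogeneous n" "Poly_Mapping.single (Jb n) 1 \<in> bms_homogeneous n" for n
    unfolding bms_homogeneous_def by (rule complex_vector.span_base; simp)+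
  have const_times: "[:[:c:]:] * g = c *\<^sub>C g" for c and g :: "complex poly poly"
    by (simp add: scaleC_poly_poly_eq_smult)
  have n_a: "[:[:- of_int n * a, 1:]:] * g = ?t * g - of_int n *\<^sub>C a *\<^sub>C g" for n a g
  proof -
    have "[:[:- of_int n * a, 1:]:] = ?t - [:[:of_int n * a:]:]" by simp
    then have "[:[:- of_int n * a, 1:]:] * g = ?t * g - [:[:of_int n * a:]:] * g"
      by (simp only: left_diff_distrib)
    then show ?thesis by (simp only: const_times scaleC_scaleC)
  qed
  have W: "slot_stable U i (\<lambda>f. \<Sum>k<2. if m < k then 0 else
      (if k = 0 then (*) ?t else (\<lambda>f. - \<alpha> i *\<^sub>C f)) (taylor_s (m - k) f))" for m
  proof (rule coeff[where X = Wb and A = "\<lambda>i k. if k = 0 then (*) ?t else (\<lambda>f. - \<alpha> i *\<^sub>C f)"])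
    fix i n f
    show "\<phi> i (Wb n) f = lam i powi n *\<^sub>C (\<Sum>k<2. of_int n ^ k *\<^sub>C
      (if k = 0 then (*) ?t else (\<lambda>f. - \<alpha> i *\<^sub>C f)) (shift_s n f))"
      unfolding phi_basis.simps n_a
      by (simp add: numeral_2_eq_2 scaleC_one complex_vector.scale_minus_left del: mult_pCons_left)
  qed (auto simp: hom simp del: complex_vector.scale_minus_left intro!: clinear_intros)
  have J: "slot_stable U i (\<lambda>f. \<Sum>k<1. if m < k then 0 else \<beta> i *\<^sub>C (taylor_s (m - k) f))" for m
    by (rule coeff[where X = Jb and A = "\<lambda>i k f. \<beta> i *\<^sub>C f"])
      (simp_all add: hom clinear_scaleC clinear_id scaleC_one scaleC_scaleC)
  have I: "slot_stable U i (\<lambda>f. \<Sum>k<2. if m < k then 0 else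
      (if k = 0 then (\<lambda>f. \<gamma> i *\<^sub>C f) else (\<lambda>f. \<beta> i *\<^sub>C (deriv_t f - H i * f))) (taylor_s (m - k) f))" for m
  proof (rule coeff[where X = Ib and A = "\<lambda>i k. if k = 0 then (\<lambda>f. \<gamma> i *\<^sub>C f)
      else (\<lambda>f. \<beta> i *\<^sub>C (deriv_t f - H i * f))"])
    fix i n f
    have *: "[:[:\<gamma> i:] - smult (of_int n * \<beta> i) (phi_H (\<alpha> i) (h i)):] * g
      = \<gamma> i *\<^sub>C g - (of_int n * \<beta> i) *\<^sub>C (H i * g)" for g
    proof -
      have "[:[:\<gamma> i:] - smult (of_int n * \<beta> i) (phi_H (\<alpha> i) (h i)):]
        = [:[:\<gamma> i:]:] - [:[:of_int n * \<beta> i:]:] * H i" by (simp add: H_def)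
      then show ?thesis by (simp only: left_diff_distrib const_times scaleC_mult_left)
    qed
    show "\<phi> i (Ib n) f = lam i powi n *\<^sub>C (\<Sum>k<2. of_int n ^ k *\<^sub>C
      (if k = 0 then (\<lambda>f. \<gamma> i *\<^sub>C f) else (\<lambda>f. \<beta> i *\<^sub>C (deriv_t f - H i * f))) (shift_s n f))"
      unfolding phi_basis.simps *
      by (simp add: numeral_2_eq_2 scaleC_one scaleC_add_right scaleC_scaleC
          complex_vector.scale_right_diff_distrib mult_ac[where 'a = complex])
  qed (auto simp: hom intro!: clinear_intros)
  \<comment> \<open>By \<open>phi_h_eq\<close>, \<open>G i\<close> and
    \<open>- \<alpha> i * H i\<close> are the multipliers at n and at its square.\<close>
  define G where "G i = [:h i + smult (\<alpha> i) (phi_H (\<alpha> i) (h i)):]" for i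
  let ?L = "\<lambda>i k. if k = 0 then (*) ?s else if k = 1 then (\<lambda>f. G i * f - ?t * deriv_t f)
      else (\<lambda>f. \<alpha> i *\<^sub>C (deriv_t f - H i * f))"
  have L: "slot_stable U i (\<lambda>f. \<Sum>k<3. if m < k then 0 else ?L i k (taylor_s (m - k) f))" for m
  proof (rule coeff[where X = Lb and A = ?L])
    show "Poly_Mapping.single (Lb n) 1 \<in> bms_homogeneous n" for n by (rule hom)
    have "clinear (\<lambda>f. G i * f - ?t * deriv_t f)" for i
      by (intro clinear_minus clinear_times clinear_compose[OF clinear_times clinear_deriv_t])
    moreover have "clinear (\<lambda>f. \<alpha> i *\<^sub>C (deriv_t f - H i * f))" for i
      by (intro clinear_scaleC clinear_minus clinear_times clinear_deriv_t)
    ultimately show "clinear (?L i k)" for i k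
      unfolding if_split[of clinear] using clinear_times by blast
    fix i n f
    have *: "(?s + [:phi_h (\<alpha> i) (h i) n:]) * g = ?s * g + of_int n *\<^sub>C (G i * g)
        - (of_int n ^ 2 * \<alpha> i) *\<^sub>C (H i * g)" for g
    proof -
      have "[:phi_h (\<alpha> i) (h i) n:] = smult [:of_int n:] (G i) - smult [:of_int n ^ 2 * \<alpha> i:] (H i)"
        by (simp add: phi_h_eq H_def G_def)
      then have "[:phi_h (\<alpha> i) (h i) n:] * g = of_int n *\<^sub>C (G i * g) - (of_int n ^ 2 * \<alpha> i) *\<^sub>C (H i * g)"
        by (simp only: scaleC_poly_poly_eq_smult left_diff_distrib mult_smult_left)
      then show ?thesis by (simp only: distrib_right add_diff_eq)
    qed
    show "\<phi> i (Lb n) f = lam i powi n *\<^sub>C (\<Sum>k<3. of_int n ^ k *\<^sub>C ?L i k (shift_s n f))"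
      unfolding phi_basis.simps n_a *
      by (simp add: numeral_3_eq_3 scaleC_one scaleC_add_right scaleC_scaleC
          complex_vector.scale_right_diff_distrib mult_ac[where 'a = complex] power2_eq_square del: mult_pCons_left mult_pCons_right)
  qed
  have t: "slot_stable U i ((*) ?t)"
    using W[of 0] by (simp add: numeral_2_eq_2 del: mult_pCons_left)
  have s: "slot_stable U i ((*) ?s)"
    using L[of 0] by (simp add: numeral_3_eq_3 del: mult_pCons_left)
  show times: "slot_stable U i ((*) p)" for p
    by (rule slot_stable_times[OF sub t s])
  show D: "slot_stable U i pderiv"
  proof (cases "\<alpha> i = 0")
    case True
    show ?thesis
    \<comment> \<open>The coefficient of n in J is \<open>- \<beta> i\<close> times the derivative,
      and \<open>\<beta> i\<close> is nonzero here by \<open>ab\<close>.\<close>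
    proof (rule slot_stable_cong[OF st(3)[OF J[of 1], of "- 1 / \<beta> i"]])
      show "(- 1 / \<beta> i) *\<^sub>C (\<Sum>k<1. if 1 < k then 0 else \<beta> i *\<^sub>C taylor_s (1 - k) f) = pderiv f" for f
        using ab True by (simp add: scaleC_scaleC scaleC_one)
    qed
  next
    case False
    define w where "w m f = ?t * taylor_s m f - \<alpha> i *\<^sub>C taylor_s (m - 1) f" for m f
    \<comment> \<open>The condition \<open>m \<ge> 1\<close> guards the natural subtraction: at
      \<open>m = 0\<close> the coefficient of W has no second summand.\<close>
    have w: "slot_stable U i (w m)" if "m \<ge> 1" for m
    proof (rule slot_stable_cong[OF W[of m]])
      show "(\<Sum>k<2. if m < k then 0 else (if k = 0 then (*) ?t else (\<lambda>f. - \<alpha> i *\<^sub>C f)) (taylor_s (m - k) f))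
        = w m f" for f
        using that by (simp add: w_def numeral_2_eq_2 complex_vector.scale_minus_left
            del: mult_pCons_left taylor_s.simps)
    qed
    have "slot_stable U i (\<lambda>f. 3 *\<^sub>C (?t * w 3 f) - w 1 (w 2 f))"
      by (rule st(2)[OF st(3)[OF st(4)[OF t w]] st(4)[OF w w]]) simp_all
    then show ?thesis
    proof (rule slot_stable_cong[OF st(3)[of i _ "1 / (\<alpha> i)\<^sup>2"]])
      fix f
      have "3 *\<^sub>C (?t * w 3 f) - w 1 (w 2 f) = (\<alpha> i)\<^sup>2 *\<^sub>C pderiv f"
        unfolding w_def by (rule pderiv_from_W_coeffs[symmetric])
      then show "(1 / (\<alpha> i)\<^sup>2) *\<^sub>C (3 *\<^sub>C (?t * w 3 f) - w 1 (w 2 f)) = pderiv f"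
        using False by (simp only: scaleC_scaleC) (simp add: scaleC_one)
    qed
  qed
  have tay: "slot_stable U i (taylor_s j)" for j
  proof (induction j)
    case 0
    show ?case by (rule slot_stable_cong[OF slot_stable_id[OF sub]]) simp
  next
    case (Suc j)
    show ?case by (rule slot_stable_cong[OF st(3)[OF st(4)[OF D Suc], of "- 1 / of_nat (Suc j)"]]) simp
  qed
  have H: "slot_stable U i ((*) (H i))" by (rule times)
  \<comment> \<open>I and L yield \<open>deriv_t f - H i * f\<close> up to a nonzero factor;
    multiplication by \<open>H i\<close> is already stable and can be added back.\<close>
  have from_scaled: "slot_stable U i deriv_t"
    if "c \<noteq> 0" "slot_stable U i (\<lambda>f. c *\<^sub>C (deriv_t f - H i * f))" for c
    by (rule slot_stable_cong[OF st(1)[OF st(3)[OF that(2), of "1 / c"] H]])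
      (use that(1) in \<open>simp add: scaleC_scaleC scaleC_one\<close>)
  show "slot_stable U i deriv_t"
  proof (cases "\<alpha> i = 0")
    case True
    \<comment> \<open>The coefficient of n in I also contains \<open>\<gamma> i\<close> times
      \<open>taylor_s 1\<close>, which is subtracted.\<close>
    have "slot_stable U i (\<lambda>f. \<beta> i *\<^sub>C (deriv_t f - H i * f))"
      by (rule slot_stable_cong[OF st(2)[OF I[of 1] st(3)[OF tay[of 1], of "\<gamma> i"]]])
        (simp add: numeral_2_eq_2 del: taylor_s.simps(2))
    then show ?thesis using from_scaled ab True by blast
  next
    case False
    define A1 where "A1 f = G i * f - ?t * deriv_t f" for f
    have A1: "slot_stable U i A1"
      by (rule slot_stable_cong[OF st(2)[OF L[of 1] st(4)[OF s tay[of 1]]]])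
        (simp add: numeral_3_eq_3 A1_def del: taylor_s.simps(2) mult_pCons_left)
    \<comment> \<open>From the coefficient of the square of n in L, the Taylor terms of the two
      lower operators, multiplication by \<open>?s\<close> and \<open>A1\<close>, are
      subtracted.\<close>
    have "slot_stable U i (\<lambda>f. \<alpha> i *\<^sub>C (deriv_t f - H i * f))"
      by (rule slot_stable_cong[OF st(2)[OF st(2)[OF L[of 2] st(4)[OF s tay[of 2]]] st(4)[OF A1 tay[of 1]]]])
        (simp add: numeral_3_eq_3 numeral_2_eq_2 A1_def del: taylor_s.simps(2) mult_pCons_left)
    then show ?thesis using from_scaled False by blast
  qed
qed

lemma irreducible_if_inj:
  assumes "inj lam" "restricted_module act" "irreducible_module act"
    and ab: "\<And>i. \<alpha> i \<noteq> 0 \<or> \<beta> i \<noteq> 0"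
  shows "irreducible_module T_act"
  unfolding irreducible_module_def
proof (intro conjI allI impI)
  let ?one = "\<lambda>_::'m. 1 :: complex poly poly"
  obtain v :: 'v where "v \<noteq> 0" using assms(3) by (auto simp: irreducible_module_def)
  then have "pure ?one v \<noteq> 0" by (simp add: pure_eq_0_iff)
  then show "\<exists>u::('m, complex poly poly, 'v) tensor. u \<noteq> 0" by blast
  fix U :: "('m, complex poly poly, 'v) tensor set"
  assume U: "submodule T_act U"
  then have sub: "complex_vector.subspace U" by (simp add: submodule_def)
  note stable = weyl_slot_stable[OF assms(1,2) U ab]
  have times: "pure (f(i := p * f i)) v \<in> U" if "pure f v \<in> U" for f i p and v :: 'v
    using stable(1)[of i p] that by (auto simp: slot_stable_def slot_pure clinear_times)
  show "U = {0} \<or> U = UNIV"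
  proof (cases "U = {0}")
    case False
    then obtain u where u: "u \<in> U" "u \<noteq> 0"
      using complex_vector.subspace_0[OF sub] by blast
    \<comment> \<open>An index pairs a slot with a variable, \<open>True\<close> for s and
      \<open>False\<close> for t, so that all derivatives form one commuting family.\<close>
    let ?D = "\<lambda>b. if b then pderiv else deriv_t :: complex poly poly \<Rightarrow> complex poly poly"
    let ?d = "\<lambda>(i, b). slot i (?D b)"
    have D: "clinear (?D b)" for b by (simp add: clinear_pderiv clinear_deriv_t)
    have "\<exists>y\<in>U. y \<noteq> 0 \<and> (\<forall>k\<in>UNIV. ?d k y = 0)"
    proof (rule exists_common_kernel[OF _ _ _ _ _ u])
      fix k l :: "'m \<times> bool" and x :: "('m, complex poly poly, 'v) tensor"
      obtain i b j c where k: "k = (i, b)" "l = (j, c)" by fastforce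
      show "clinear (?d k)" using D by (simp add: k clinear_slot)
      have "?D b (?D c f) = ?D c (?D b f)" for f by (simp add: pderiv_deriv_t)
      then show "?d k (?d l x) = ?d l (?d k x)"
        by (simp only: k prod.case) (intro slot_commute D, blast)
      show "\<exists>N. (?d k ^^ N) x = 0"
        by (simp add: k slot_nilpotent_pderiv slot_nilpotent_deriv_t)
      show "?d k x \<in> U" if "x \<in> U"
        using that stable(2,3)[of i] by (simp add: k slot_stable_def)
    qed simp
    then obtain y where y: "y \<in> U" "y \<noteq> 0" "\<And>i b. slot i (?D b) y = 0" by fastforce
    have "\<exists>v. y = pure ?one v"
      using y(3)[of _ True] y(3)[of _ False] by (intro ex_pure_one) simp_all
    then obtain v where v: "y = pure ?one v" by blast
    then have "v \<noteq> 0" using y(2) by (auto simp: clinear_0[OF clinear_pure])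
    define V where "V = {v. pure ?one v \<in> U}"
    have "submodule act V"
      unfolding submodule_def
    proof (intro conjI allI ballI)
      show "complex_vector.subspace V"
        using sub by (auto simp: V_def complex_vector.subspace_def clinear_0[OF clinear_pure]
            clinear_add[OF clinear_pure] clinear_scale[OF clinear_pure])
      fix x w assume w: "w \<in> V"
      have "T_act x (pure ?one w) = (\<Sum>i\<in>UNIV. pure (?one(i := \<Phi> i x 1)) w) + pure ?one (act x w)"
        by (rule tensor_act_pure[of \<Phi> x act, OF clinear_phi_act(1) clinear_act])
      \<comment> \<open>Each term \<open>\<Phi> i x 1\<close> arises from 1 by a multiplication and
        so stays in \<open>U\<close>; this isolates the action on \<open>w\<close>.\<close>
      then have "pure ?one (act x w) = T_act x (pure ?one w) - (\<Sum>i\<in>UNIV. pure (?one(i := \<Phi> i x 1)) w)"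
        by simp
      moreover have "T_act x (pure ?one w) \<in> U"
        using U w by (simp add: V_def submodule_def)
      moreover have "pure (?one(i := \<Phi> i x 1)) w \<in> U" for i
        using times[of ?one w i "\<Phi> i x 1"] w by (simp add: V_def)
      ultimately have "pure ?one (act x w) \<in> U"
        using sub by (auto intro!: complex_vector.subspace_diff complex_vector.subspace_sum)
      then show "act x w \<in> V" by (simp add: V_def)
    qed
    moreover have "v \<in> V" using y(1) v by (simp add: V_def)
    ultimately have V: "V = UNIV"
      using assms(3) \<open>v \<noteq> 0\<close> by (auto simp: irreducible_module_def)
    have pure_mem: "pure f w \<in> U" for f w
    proof -
      \<comment> \<open>The slots are filled one at a time by multiplication, starting from 1 in
        every slot.\<close>
      have "pure (\<lambda>i. if i \<in> I then f i else 1) w \<in> U" if "finite I" for I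
        using that
      proof (induction I rule: finite_induct)
        case empty
        have "w \<in> V" using V by simp
        then show ?case by (simp add: V_def)
      next
        case (insert i I)
        have "(\<lambda>j. if j \<in> insert i I then f j else 1)
          = (\<lambda>j. if j \<in> I then f j else 1)(i := f i * (if i \<in> I then f i else 1))"
          using insert.hyps by (auto simp: fun_eq_iff)
        then show ?case using times[OF insert.IH, of i "f i"] by (simp only:)
      qed
      from this[of UNIV] show ?thesis by simp
    qed
    have "w \<in> U" for w
      by (induction w rule: pure_induct) (simp_all add: pure_mem complex_vector.subspace_add[OF sub])
    then show ?thesis by blast
  qed simp
qed

end

theorem corollary3p6:
  fixes lam \<alpha> \<beta> \<gamma> :: "'m::finite \<Rightarrow> complex"
    and h :: "'m \<Rightarrow> complex poly"
    and act :: "bms \<Rightarrow> 'v::complex_vector \<Rightarrow> 'v"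
  assumes "\<And>i. lam i \<noteq> 0"
    and "\<And>i. \<alpha> i \<noteq> 0 \<or> \<beta> i \<noteq> 0"
    and "lie_module bms_bracket act"
    and "irreducible_module act"
    and "restricted_module act"
  shows "irreducible_module
      (tensor_act (\<lambda>i. phi_act (lam i) (\<alpha> i) (\<beta> i) (\<gamma> i) (h i)) act)
    \<longleftrightarrow> inj lam"
proof
  obtain v :: 'v where "v \<noteq> 0" using assms(4) by (auto simp: irreducible_module_def)
  then show "inj lam" if "irreducible_module (tensor_act (\<lambda>i. phi_act (lam i) (\<alpha> i) (\<beta> i) (\<gamma> i) (h i)) act)"
    using not_irreducible_if_eq[where lam = lam and \<alpha> = \<alpha> and \<beta> = \<beta> and \<gamma> = \<gamma> and h = h, OF assms(1,3)]
      that by (intro injI) blast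
  show "irreducible_module (tensor_act (\<lambda>i. phi_act (lam i) (\<alpha> i) (\<beta> i) (\<gamma> i) (h i)) act)" if "inj lam"
    by (rule irreducible_if_inj[OF assms(1,3) that assms(5,4,2)])
qed

end
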